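(* Let $n\ge 2$, let $\mathcal{P}_1$ and $\mathcal{P}_2$ be generalized $n$-dimensional polytopes in $\mathbb{R}^n$, and let $\mathcal{S}=\{\boldsymbol{\sigma}(\mathbf{t}):\mathbf{t}\in D\}$ be a rationally parameterisable hypersurface in $\mathbb{R}^n$. Assume that there exists an open subset $O$ of $D\setminus\sigma_1^{-1}(0)$ in $\mathbb{R}^{n-1}$ that satisfies the hyperplane condition and the inner point condition. If \[F_{\mathcal{P}_1}(\boldsymbol{\sigma}(\mathbf{t}))=F_{\mathcal{P}_2}(\boldsymbol{\sigma}(\mathbf{t}))\quad\text{for all }\mathbf{t}\in O,\] then $\mathcal{P}_1=\mathcal{P}_2$.
   Context: A generalized $n$-dimensional polytope in $\mathbb{R}^n$ is a union of finitely many convex $n$-dimensional polytopes in $\mathbb{R}^n$. For such a $\mathcal{P}$, its Fourier transform is $F_{\mathcal{P}}(\mathbf{s})=\int_{\mathcal{P}}e^{-i\,\mathbf{s}\cdot\mathbf{x}}\,d\mathbf{x}$ ($\cdot$ the standard scalar product). A rationally parameterisable hypersurface (rp-hypersurface) is a set $\mathcal{S}=\{\boldsymbol{\sigma}(\mathbf{t}):\mathbf{t}\in D\}\subseteq\mathbb{R}^n$, where $\boldsymbol{\sigma}=(\sigma_1,\dots,\sigma_n)^T:\mathbb{R}^{n-1}\to\mathbb{R}^n$ has rational functions $\sigma_j(t_1,\dots,t_{n-1})$ as components and $D\subseteq\mathbb{R}^{n-1}$ (the domain) is a set on which all $\sigma_j$ are defined. $\sigma_1^{-1}(0)$ denotes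 the zero set of $\sigma_1$. The normalized function is $\hat{\boldsymbol{\sigma}}(\mathbf{t})=\big(\sigma_2(\mathbf{t})/\sigma_1(\mathbf{t}),\dots,\sigma_n(\mathbf{t})/\sigma_1(\mathbf{t})\big)^T\in\mathbb{R}^{n-1}$ for $\mathbf{t}\in D\setminus\sigma_1^{-1}(0)$, and $\hat{\boldsymbol{\sigma}}(O)=\{\hat{\boldsymbol{\sigma}}(\mathbf{t}):\mathbf{t}\in O\}$. For an open set $O\subseteq D\setminus\sigma_1^{-1}(0)$: the hyperplane condition means that $\boldsymbol{\sigma}(O)=\{\boldsymbol{\sigma}(\mathbf{t}):\mathbf{t}\in O\}$ is not contained in any (affine) hyperplane of $\mathbb{R}^n$; the inner point condition means that there is $\mathbf{t}\in O$ such that $\hat{\boldsymbol{\sigma}}(\mathbf{t})$ is an interior point of $\hat{\boldsymbol{\sigma}}(O)$ in $\mathbb{R}^{n-1}$. *)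

theory Defs
  imports "HOL-Analysis.Analysis"
begin

text \<open>Coordinates of R^n are indexed by the type 'm option, where 'm indexes the
  coordinates of the parameter space R^(n-1). The coordinate None plays the role of the
  first coordinate (sigma_1), the coordinates Some j the remaining ones. Thus n = CARD('m) + 1
  and n >= 2 holds automatically.\<close>

definition polynomial_fun :: "(real^'m \<Rightarrow> real) \<Rightarrow> bool" where
  "polynomial_fun p \<longleftrightarrow>
     (\<exists>M :: ('m \<Rightarrow> nat) set. \<exists>c :: ('m \<Rightarrow> nat) \<Rightarrow> real. finite M \<and>
        (\<forall>x. p x = (\<Sum>\<alpha>\<in>M. c \<alpha> * (\<Prod>i\<in>UNIV. (x $ i) ^ (\<alpha> i)))))"

definition rational_fun_on :: "(real^'m) set \<Rightarrow> (real^'m \<Rightarrow> real) \<Rightarrow> bool" where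
  "rational_fun_on D f \<longleftrightarrow>
     (\<exists>p q. polynomial_fun p \<and> polynomial_fun q \<and>
        (\<forall>t\<in>D. q t \<noteq> 0 \<and> f t = p t / q t))"

definition rp_param :: "(real^'m \<Rightarrow> real^('m option)) \<Rightarrow> (real^'m) set \<Rightarrow> bool" where
  "rp_param \<sigma> D \<longleftrightarrow> (\<forall>j. rational_fun_on D (\<lambda>t. \<sigma> t $ j))"

definition convex_polytope_full :: "(real^'n) set \<Rightarrow> bool" where
  "convex_polytope_full P \<longleftrightarrow> polytope P \<and> aff_dim P = int CARD('n)"

definition generalized_polytope :: "(real^'n) set \<Rightarrow> bool" where
  "generalized_polytope P \<longleftrightarrow>
     (\<exists>\<F>. finite \<F> \<and> \<F> \<noteq> {} \<and> (\<forall>Q\<in>\<F>. convex_polytope_full Q) \<and> P = \<Union>\<F>)"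

definition fourier_transform :: "(real^'n) set \<Rightarrow> real^'n \<Rightarrow> complex" where
  "fourier_transform P s = integral P (\<lambda>x. exp (- \<i> * complex_of_real (s \<bullet> x)))"

definition normalized :: "(real^'m \<Rightarrow> real^('m option)) \<Rightarrow> real^'m \<Rightarrow> real^'m" where
  "normalized \<sigma> t = (\<chi> j. \<sigma> t $ Some j / \<sigma> t $ None)"

definition hyperplane_condition :: "(real^'m \<Rightarrow> real^('m option)) \<Rightarrow> (real^'m) set \<Rightarrow> bool" where
  "hyperplane_condition \<sigma> O' \<longleftrightarrow>
     \<not> (\<exists>a b. a \<noteq> 0 \<and> \<sigma> ` O' \<subseteq> {x. a \<bullet> x = b})"

definition inner_point_condition :: "(real^'m \<Rightarrow> real^('m option)) \<Rightarrow> (real^'m) set \<Rightarrow> bool" where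
  "inner_point_condition \<sigma> O' \<longleftrightarrow>
     (\<exists>t\<in>O'. normalized \<sigma> t \<in> interior (normalized \<sigma> ` O'))"

end

theory Submission
  imports Defs
    "HOL-Computational_Algebra.Polynomial_Factorial"
    "HOL-Computational_Algebra.Fundamental_Theorem_Algebra"
    "HOL-Computational_Algebra.Field_as_Ring"
begin

text \<open>By inclusion-exclusion, triangulation and an explicit integration over simplices, the Fourier
  transform of a generalized polytope is \<open>F s = (\<Sum>v. R v s * exp (- \<i> * (v \<bullet> s)))\<close> with rational
  coefficients \<open>R v\<close> homogeneous of degree \<open>-n\<close>. Write the difference of the two transforms in this form
  and substitute \<open>s = \<sigma> t\<close>. By the hyperplane condition the exponents \<open>v \<bullet> \<sigma> t\<close> differ pairwise by
  nonconstant rational functions, so the exponentials are linearly independent over the rational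
  functions and every \<open>R v\<close> vanishes on \<open>\<sigma> ` O'\<close>. By homogeneity \<open>R v\<close> vanishes at the points
  \<open>(1, y)\<close> with \<open>y\<close> in the image of the normalized map, which has an interior point, so \<open>R v = 0\<close>.
  Hence the transforms agree everywhere, and integrating against trigonometric polynomials that
  approximate a bump function shows that the polytopes are equal.\<close>

section \<open>Independence of exponentials of rational functions\<close>

text \<open>The quotients \<open>R v = N v / Q\<close> need not be defined on the hypersurface,
  since \<open>Q\<close> may vanish identically there. The cleared identity between
  \<open>Q s * F s\<close> and the exponential sum with coefficients \<open>N v s\<close> holds for
  every \<open>s\<close>, so the argument runs on the numerators alone: they vanish on the image of
  \<sigma>, then everywhere. Only then is \<open>Q\<close> cancelled, using that it is a nonzero
  polynomial and that the transforms are continuous. A nonzero polynomial can vanish on a whole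
  hypersurface, so vanishing on the image would not suffice without homogeneity, which spreads zeros
  along lines through the origin. The affine form of the hyperplane condition fits the independence
  statement: exponentials whose exponents differ by a constant are proportional. Independence is
  proved in one variable, on a segment, because there orders of zeros and degrees are available.
  Finally, equal transforms determine a set only up to null sets; the full dimension of the convex
  pieces is what upgrades this to equality.\<close>

lemma power_dvd_mult_pderiv:
  fixes q X :: "'a::idom poly"
  assumes "X ^ b dvd q" "pderiv X = 1"
  shows "X ^ b dvd X * pderiv q"
proof (cases b)
  case (Suc m)
  obtain r where r: "q = X ^ b * r" using assms by (auto elim: dvdE)
  \<comment> \<open>The factor \<open>X\<close> compensates for the order that differentiation can
    lose, so no exponent \<open>b - 1\<close> appears.\<close>
  have "X * pderiv q = X ^ b * (smult (of_nat b) r + X * pderiv r)"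
    unfolding r pderiv_mult pderiv_power_Suc Suc
    by (simp add: algebra_simps assms(2))
  then show ?thesis by simp
qed auto

text \<open>After clearing the denominator \<open>p * q\<close>, this is the vanishing at infinity
  of the logarithmic derivative of \<open>q / p\<close>. A nonzero Wronskian rules out that both
  polynomials are constant, where strictness fails.\<close>

lemma degree_wronskian_less:
  fixes p q :: "complex poly"
  assumes "p * pderiv q - q * pderiv p \<noteq> 0"
  shows "degree (p * pderiv q - q * pderiv p) < degree p + degree q"
proof -
  have "degree p + degree q > 0"
  proof (rule ccontr)
    assume "\<not> ?thesis"
    then have "pderiv p = 0" "pderiv q = 0" by (auto simp: pderiv_eq_0_iff)
    with assms show False by simp
  qed
  moreover have "degree (f * pderiv g) < degree f + degree g"
    if "degree f + degree g > 0" for f g :: "complex poly"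
  proof (cases "degree g = 0")
    case True
    then have "pderiv g = 0" by (simp add: pderiv_eq_0_iff)
    then show ?thesis using that by simp
  next
    case False
    then show ?thesis using degree_mult_le[of f "pderiv g"] by (simp add: degree_pderiv)
  qed
  ultimately have "degree (p * pderiv q) < degree p + degree q" "degree (q * pderiv p) < degree p + degree q"
    by (metis add.commute)+
  then show ?thesis by (rule degree_diff_less)
qed

text \<open>The equation says \<open>(q/p)'/(q/p) = (u/w)'\<close>: a logarithmic derivative has only simple poles and
  vanishes at infinity, whereas the derivative of a nonconstant rational function has a pole of order
  at least two or does not vanish at infinity.\<close>
lemma log_derivative_rational_const:
  fixes p q u w :: "complex poly"
  assumes "p \<noteq> 0" "q \<noteq> 0" "w \<noteq> 0"
    and eq: "w\<^sup>2 * (p * pderiv q - q * pderiv p) = p * q * (pderiv u * w - u * pderiv w)"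
  shows "\<exists>c. u = smult c w"
proof -
  \<comment> \<open>In lowest terms numerator and denominator have no common root. The terms with
    \<open>pderiv d\<close> cancel, so the equation only loses the factor
    \<open>d^2\<close>.\<close>
  define d where "d = gcd u w"
  have "d \<noteq> 0" using \<open>w \<noteq> 0\<close> by (simp add: d_def)
  obtain u0 w0 where u: "u = d * u0" and w: "w = d * w0" and cop: "coprime u0 w0"
    unfolding d_def using \<open>w \<noteq> 0\<close> by (metis gcd_coprime_exists gcd_eq_0_iff mult.commute)
  have "w0 \<noteq> 0" using w \<open>w \<noteq> 0\<close> by auto
  have "d\<^sup>2 * (w0\<^sup>2 * (p * pderiv q - q * pderiv p)) = d\<^sup>2 * (p * q * (pderiv u0 * w0 - u0 * pderiv w0))"
    using eq unfolding u w by (simp add: pderiv_mult power2_eq_square algebra_simps)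
  then have eq0: "w0\<^sup>2 * (p * pderiv q - q * pderiv p) = p * q * (pderiv u0 * w0 - u0 * pderiv w0)"
    using \<open>d \<noteq> 0\<close> by simp
  have noroot: "poly w0 x \<noteq> 0" for x
  proof
    assume x: "poly w0 x = 0"
    define X where "X = [:-x,1:]"
    have X: "X ^ i dvd f \<longleftrightarrow> f = 0 \<or> i \<le> order x f" for i f
      unfolding X_def by (auto simp: order_divides)
    have pX: "pderiv X = 1" by (simp add: X_def pderiv_pCons)
    have X0: "X dvd f \<longleftrightarrow> poly f x = 0" for f by (simp add: X_def poly_eq_0_iff_dvd)
    define n a b where "n = order x w0" and "a = order x p" and "b = order x q"
    have n: "n > 0" using x \<open>w0 \<noteq> 0\<close> by (simp add: n_def order_gt_0_iff)
    have "poly u0 x \<noteq> 0"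
    proof
      assume "poly u0 x = 0"
      then have "X dvd u0" "X dvd w0" using x by (auto simp: X0)
      then have "is_unit X" using cop by (meson coprime_common_divisor)
      then show False by (simp add: X_def is_unit_iff_degree)
    qed
    obtain w1 where w1: "w0 = X * w1" using x by (auto simp: X0[symmetric])
    have Xn: "X ^ n dvd w0" unfolding n_def X_def by (rule order_1)
    have Xa: "X ^ a dvd p" "X ^ b dvd q" unfolding a_def b_def X_def by (rule order_1)+
    \<comment> \<open>One of the two factors \<open>w0\<close> supplies \<open>X ^ n\<close>, the
      other the single \<open>X\<close> that makes the Wronskian a multiple of
      \<open>X ^ (a + b)\<close>. So the left side has order at least \<open>a + b + n\<close> at
      \<open>x\<close>, whereas the pole of order \<open>n + 1\<close> on the right leaves it with a
      smaller order.\<close>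
    have "X ^ (a + b) dvd p * (X * pderiv q) - q * (X * pderiv p)"
      unfolding power_add
      using mult_dvd_mono[OF Xa(1) power_dvd_mult_pderiv[OF Xa(2) pX]]
        mult_dvd_mono[OF power_dvd_mult_pderiv[OF Xa(1) pX] Xa(2)]
      by (intro dvd_diff) (auto simp only: mult.commute)
    then have "X ^ (a + b) * X ^ n dvd (p * (X * pderiv q) - q * (X * pderiv p)) * (w0 * w1)"
      using Xn by (intro mult_dvd_mono) auto
    also have "\<dots> = w0\<^sup>2 * (p * pderiv q - q * pderiv p)"
    proof -
      have "w0\<^sup>2 = w0 * (X * w1)" using w1 by (simp add: power2_eq_square)
      then show ?thesis by (simp only: algebra_simps)
    qed
    also have "\<dots> = (p * q) * (pderiv u0 * w0 - u0 * pderiv w0)" by (simp add: eq0)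
    finally have *: "X ^ (a + b) * X ^ n dvd (p * q) * (pderiv u0 * w0 - u0 * pderiv w0)" .
    have "pderiv w0 \<noteq> 0"
    proof
      assume "pderiv w0 = 0"
      then obtain k where "w0 = [:k:]" by (auto simp: pderiv_eq_0_iff elim: degree_eq_zeroE)
      then show False using x \<open>w0 \<noteq> 0\<close> by simp
    qed
    have nd: "\<not> X ^ n dvd pderiv w0"
    proof
      assume "X ^ n dvd pderiv w0"
      then have "n \<le> order x (pderiv w0)" using \<open>pderiv w0 \<noteq> 0\<close> X by blast
      moreover have "order x w0 = Suc (order x (pderiv w0))"
        by (rule order_pderiv) (use \<open>w0 \<noteq> 0\<close> \<open>pderiv w0 \<noteq> 0\<close> n n_def x in auto)
      ultimately show False by (simp add: n_def)
    qed
    have nd2: "\<not> X ^ n dvd pderiv u0 * w0 - u0 * pderiv w0"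
    proof
      assume "X ^ n dvd pderiv u0 * w0 - u0 * pderiv w0"
      from dvd_diff[OF dvd_mult[OF Xn, of "pderiv u0"] this]
      have h: "X ^ n dvd u0 * pderiv w0" by simp
      have "u0 * pderiv w0 \<noteq> 0" using \<open>poly u0 x \<noteq> 0\<close> \<open>pderiv w0 \<noteq> 0\<close> by auto
      then have "n \<le> order x u0 + order x (pderiv w0)"
        using h X order_mult by metis
      moreover have "order x u0 = 0" using \<open>poly u0 x \<noteq> 0\<close> by (rule order_0I)
      ultimately show False using nd X \<open>pderiv w0 \<noteq> 0\<close> by auto
    qed
    then have nz: "pderiv u0 * w0 - u0 * pderiv w0 \<noteq> 0" by auto
    have "p * q * (pderiv u0 * w0 - u0 * pderiv w0) \<noteq> 0" using nz assms by auto
    then have "a + b + n \<le> order x (p * q * (pderiv u0 * w0 - u0 * pderiv w0))"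
      using * X by (metis power_add)
    also have "\<dots> = a + b + order x (pderiv u0 * w0 - u0 * pderiv w0)"
      using nz assms by (simp add: order_mult a_def b_def)
    finally show False using nd2 nz X by auto
  qed
  then have "constant (poly w0)" using fundamental_theorem_of_algebra by blast
  then have "degree w0 = 0" by (simp add: constant_degree)
  then obtain k where k: "w0 = [:k:]" by (auto elim: degree_eq_zeroE)
  have "k \<noteq> 0" using k \<open>w0 \<noteq> 0\<close> by auto
  \<comment> \<open>No finite poles remain, so \<open>u0 / w0\<close> is a polynomial. Unless it is
    constant, the right side has degree at least \<open>degree p + degree q\<close>, against
    \<open>degree_wronskian_less\<close>.\<close>
  have "pderiv u0 = 0"
  proof (rule ccontr)
    assume nz: "pderiv u0 \<noteq> 0"
    have e: "smult (k^2) (p * pderiv q - q * pderiv p) = smult k (p * q * pderiv u0)"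
      using eq0 unfolding k by (simp add: power2_eq_square pderiv_pCons)
    then have "p * pderiv q - q * pderiv p \<noteq> 0" using nz assms \<open>k \<noteq> 0\<close> by auto
    note degree_wronskian_less[OF this]
    moreover have "degree (p * pderiv q - q * pderiv p) = degree (p * q * pderiv u0)"
      using e \<open>k \<noteq> 0\<close> by (metis degree_smult_eq power_not_zero)
    ultimately show False using nz assms by (simp add: degree_mult_eq)
  qed
  then have "degree u0 = 0" by (simp add: pderiv_eq_0_iff)
  then obtain c where "u0 = [:c:]" by (auto elim: degree_eq_zeroE)
  then have "u = smult (c / k) w" unfolding u w k using \<open>k \<noteq> 0\<close> by simp
  then show ?thesis ..
qed

lemma poly_eq_0_if_zero_on_infinite_reals:
  assumes "infinite T" "\<And>t. t \<in> T \<Longrightarrow> poly p (complex_of_real t) = 0"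
  shows "p = 0"
proof (rule ccontr)
  assume "p \<noteq> 0"
  have "complex_of_real ` T \<subseteq> {z. poly p z = 0}" using assms(2) by auto
  moreover have "infinite (complex_of_real ` T)"
    using assms(1) by (subst finite_image_iff) (auto simp: inj_on_def)
  ultimately show False using poly_roots_finite[OF \<open>p \<noteq> 0\<close>] finite_subset by blast
qed

text \<open>Vanishing of the eliminated coefficient \<open>r k\<close> says that the logarithmic
  derivative of \<open>p k / p j\<close> is the derivative of \<open>(u j - u k) / w\<close>, which
  \<open>log_derivative_rational_const\<close> allows only for exponents with constant difference.
  Because of the common denominator \<open>w\<close>, multiplication by \<open>w\<^sup>2\<close>
  makes all coefficients polynomial after differentiation.\<close>

lemma exp_rational_independent:
  fixes p u :: "'k \<Rightarrow> complex poly"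
  assumes "finite K" "a < b"
    and "\<And>k l. k \<in> K \<Longrightarrow> l \<in> K \<Longrightarrow> k \<noteq> l \<Longrightarrow> \<not> (\<exists>c. u k - u l = smult c w)"
    and w0: "\<And>t. t \<in> {a<..<b} \<Longrightarrow> poly w (complex_of_real t) \<noteq> 0"
    and "\<And>t. t \<in> {a<..<b} \<Longrightarrow>
      (\<Sum>k\<in>K. poly (p k) (of_real t) * exp (poly (u k) (of_real t) / poly w (of_real t))) = 0"
  shows "\<forall>k\<in>K. p k = 0"
  using assms(1,3,5)
proof (induction K arbitrary: p rule: finite_induct)
  case (insert j K)
  have "w \<noteq> 0" using w0[of "(a+b)/2"] \<open>a < b\<close> by auto
  define v where "v k = pderiv (u k) * w - u k * pderiv w" for k
  define e where "e k z = exp (poly (u k) z / poly w z)" for k z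
  \<comment> \<open>Differentiating the relation and eliminating the \<open>j\<close>-th exponential leaves a shorter relation,
    still with polynomial coefficients.\<close>
  define r where "r k = p j * (w\<^sup>2 * pderiv (p k) + p k * v k) - p k * (w\<^sup>2 * pderiv (p j) + p j * v j)" for k
  have S: "(\<Sum>k\<in>insert j K. poly (p k) (of_real t) * e k (of_real t)) = 0" if "t \<in> {a<..<b}" for t
    using insert.prems(2)[OF that] by (simp add: e_def)
  have der: "(\<Sum>k\<in>insert j K. poly (w\<^sup>2 * pderiv (p k) + p k * v k) (of_real t) * e k (of_real t)) = 0"
    if t: "t \<in> {a<..<b}" for t
  proof -
    define z where "z = complex_of_real t"
    have wz: "poly w z \<noteq> 0" using w0[OF t] by (simp add: z_def)
    define D where "D = (\<Sum>k\<in>insert j K. poly (pderiv (p k)) z * e k z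
         + poly (p k) z * (e k z * (poly (v k) z / (poly w z)\<^sup>2)))"
    have de: "(e k has_field_derivative e k z * (poly (v k) z / (poly w z)\<^sup>2)) (at z)" for k
    proof -
      have "((\<lambda>z. exp (poly (u k) z / poly w z)) has_field_derivative
        exp (poly (u k) z / poly w z) * ((poly (pderiv (u k)) z * poly w z - poly (u k) z * poly (pderiv w) z)
          / (poly w z * poly w z))) (at z)"
        by (intro DERIV_chain2[where f = exp] DERIV_exp DERIV_divide poly_DERIV wz)
      then show ?thesis unfolding e_def[abs_def] v_def by (simp add: power2_eq_square)
    qed
    have "((\<lambda>z. \<Sum>k\<in>insert j K. poly (p k) z * e k z) has_field_derivative D) (at z)"
      unfolding D_def
    proof (intro DERIV_sum)
      fix k
      show "((\<lambda>z. poly (p k) z * e k z) has_field_derivative poly (pderiv (p k)) z * e k z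
         + poly (p k) z * (e k z * (poly (v k) z / (poly w z)\<^sup>2))) (at z)"
        using DERIV_mult[OF poly_DERIV[of "p k" z] de[of k]] by (simp add: mult_ac)
    qed
    then have hv: "((\<lambda>t. \<Sum>k\<in>insert j K. poly (p k) (of_real t) * e k (of_real t)) has_vector_derivative D) (at t)"
      unfolding z_def
      by (rule has_vector_derivative_real_field)
    have "((\<lambda>t::real. 0) has_vector_derivative D) (at t)"
      by (rule has_vector_derivative_transform_within_open[OF hv, of "{a<..<b}"]) (use t S in auto)
    then have "D = 0" by (metis has_vector_derivative_const vector_derivative_unique_at)
    then have "(poly w z)\<^sup>2 * D = 0" by simp
    also have "(poly w z)\<^sup>2 * D = (\<Sum>k\<in>insert j K. poly (w\<^sup>2 * pderiv (p k) + p k * v k) z * e k z)"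
      unfolding D_def sum_distrib_left
    proof (rule sum.cong)
      fix k
      have "W * (A * E + B * (E * (V / W))) = (W * A + B * V) * E" if "W \<noteq> 0" for W A B E V :: complex
        using that by (simp add: field_simps)
      then show "(poly w z)\<^sup>2 * (poly (pderiv (p k)) z * e k z + poly (p k) z * (e k z * (poly (v k) z / (poly w z)\<^sup>2)))
        = poly (w\<^sup>2 * pderiv (p k) + p k * v k) z * e k z"
        using wz by simp
    qed simp
    finally show ?thesis by (simp add: z_def)
  qed
  show ?case
  proof (cases "p j = 0")
    case True
    then have "\<forall>k\<in>K. p k = 0"
      by (intro insert.IH) (use insert in auto)
    with True show ?thesis by simp
  next
    case False
    have "\<forall>k\<in>K. r k = 0"
    proof (rule insert.IH)
      fix t assume t: "t \<in> {a<..<b}"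
      define z where "z = complex_of_real t"
      have "(\<Sum>k\<in>insert j K. poly (r k) z * e k z) =
        poly (p j) z * (\<Sum>k\<in>insert j K. poly (w\<^sup>2 * pderiv (p k) + p k * v k) z * e k z)
        - poly (w\<^sup>2 * pderiv (p j) + p j * v j) z * (\<Sum>k\<in>insert j K. poly (p k) z * e k z)"
        unfolding sum_distrib_left sum_subtractf[symmetric]
        by (rule sum.cong) (auto simp: r_def algebra_simps)
      also have "\<dots> = 0" using S[OF t] der[OF t] by (simp add: z_def)
      \<comment> \<open>\<open>r j\<close> is the zero polynomial by construction, so the sum over
        \<open>insert j K\<close> reduces to \<open>K\<close>.\<close>
      finally show "(\<Sum>k\<in>K. poly (r k) (of_real t) * exp (poly (u k) (of_real t) / poly w (of_real t))) = 0"
        using insert.hyps by (simp add: z_def e_def r_def algebra_simps)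
    qed (use insert in auto)
    then have pk: "p k = 0" if "k \<in> K" for k
    proof (rule_tac ccontr)
      assume nz: "p k \<noteq> 0"
      have "r k = 0" using that \<open>\<forall>k\<in>K. r k = 0\<close> by blast
      then have "w\<^sup>2 * (p j * pderiv (p k) - p k * pderiv (p j)) =
          p j * p k * (pderiv (u j - u k) * w - (u j - u k) * pderiv w)"
        unfolding r_def v_def by (simp add: algebra_simps pderiv_diff)
      from log_derivative_rational_const[OF False nz \<open>w \<noteq> 0\<close> this]
      show False using insert.prems(1)[of j k] insert.hyps that by auto
    qed
    \<comment> \<open>Only the \<open>j\<close>-th term is left, and \<open>exp\<close> has no
      zeros.\<close>
    have "poly (p j) (of_real t) = 0" if "t \<in> {a<..<b}" for t
      using S[OF that] insert.hyps by (simp add: pk e_def)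
    then have "p j = 0"
      using \<open>a < b\<close> by (intro poly_eq_0_if_zero_on_infinite_reals[of "{a<..<b}"]) (auto simp: infinite_Ioo)
    with False show ?thesis by simp
  qed
qed simp

section \<open>Complex polynomial functions of several variables\<close>

text \<open>Closure rules instead of coefficient families let substitution and restriction to lines
  be proved by rule induction.\<close>

inductive cpoly_fun :: "(real^'n \<Rightarrow> complex) \<Rightarrow> bool" where
  const: "cpoly_fun (\<lambda>x. c)"
| coord: "cpoly_fun (\<lambda>x. of_real (x $ i))"
| add: "cpoly_fun f \<Longrightarrow> cpoly_fun g \<Longrightarrow> cpoly_fun (\<lambda>x. f x + g x)"
| mult: "cpoly_fun f \<Longrightarrow> cpoly_fun g \<Longrightarrow> cpoly_fun (\<lambda>x. f x * g x)"

lemma cpoly_fun_diff: "cpoly_fun f \<Longrightarrow> cpoly_fun g \<Longrightarrow> cpoly_fun (\<lambda>x. f x - g x)"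
  using cpoly_fun.add[OF _ cpoly_fun.mult[OF cpoly_fun.const[of "-1"]], of f g] by simp

lemma cpoly_fun_sum: "(\<And>i. i \<in> I \<Longrightarrow> cpoly_fun (f i)) \<Longrightarrow> cpoly_fun (\<lambda>x. \<Sum>i\<in>I. f i x)"
  by (induction I rule: infinite_finite_induct) (auto intro: cpoly_fun.intros)

lemma cpoly_fun_prod: "(\<And>i. i \<in> I \<Longrightarrow> cpoly_fun (f i)) \<Longrightarrow> cpoly_fun (\<lambda>x. \<Prod>i\<in>I. f i x)"
  by (induction I rule: infinite_finite_induct) (auto intro: cpoly_fun.intros)

lemma cpoly_fun_power: "cpoly_fun f \<Longrightarrow> cpoly_fun (\<lambda>x. f x ^ k)"
  by (induction k) (auto intro: cpoly_fun.intros)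

lemma cpoly_fun_compose:
  assumes "cpoly_fun f" "\<And>i. cpoly_fun (\<lambda>x. of_real (P x $ i))"
  shows "cpoly_fun (\<lambda>x. f (P x))"
  using assms(1) by induction (auto intro: cpoly_fun.intros assms)

lemma cpoly_fun_inner_compose:
  assumes "\<And>i. cpoly_fun (\<lambda>x. of_real (P x $ i))"
  shows "cpoly_fun (\<lambda>x. of_real (v \<bullet> P x))"
  unfolding inner_vec_def of_real_sum
  by (intro cpoly_fun_sum) (auto intro!: cpoly_fun.mult cpoly_fun.const assms)

lemma cpoly_fun_line:
  assumes "cpoly_fun f"
  obtains p where "\<And>t::real. f (a + t *\<^sub>R d) = poly p (of_real t)"
proof -
  from assms have "\<exists>p. \<forall>t::real. f (a + t *\<^sub>R d) = poly p (of_real t)"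
  proof induction
    case (const c)
    show ?case by (rule exI[of _ "[:c:]"]) simp
  next
    case (coord i)
    show ?case by (rule exI[of _ "[:of_real (a $ i), of_real (d $ i):]"]) simp
  next
    case (add f g)
    then obtain p q where "\<forall>t::real. f (a + t *\<^sub>R d) = poly p (of_real t)"
      "\<forall>t::real. g (a + t *\<^sub>R d) = poly q (of_real t)" by blast
    then show ?case by (intro exI[of _ "p + q"]) simp
  next
    case (mult f g)
    then obtain p q where "\<forall>t::real. f (a + t *\<^sub>R d) = poly p (of_real t)"
      "\<forall>t::real. g (a + t *\<^sub>R d) = poly q (of_real t)" by blast
    then show ?case by (intro exI[of _ "p * q"]) simp
  qed
  then show ?thesis using that by blast
qed

text \<open>On the line through \<open>a\<close> and \<open>x\<close> the function is a univariate
  polynomial that vanishes for the infinitely many parameters near 0, and \<open>x\<close> sits at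
  parameter 1.\<close>

lemma cpoly_fun_eq_0_if_zero_on_open:
  assumes f: "cpoly_fun f" and "open U" "a \<in> U" and 0: "\<And>x. x \<in> U \<Longrightarrow> f x = 0"
  shows "f x = 0"
proof -
  obtain p where p: "\<And>t::real. f (a + t *\<^sub>R (x - a)) = poly p (of_real t)"
    using cpoly_fun_line[OF f] by blast
  define T where "T = (\<lambda>t::real. a + t *\<^sub>R (x - a)) -` U"
  have "open T" unfolding T_def
    by (intro open_vimage \<open>open U\<close>) (auto intro!: continuous_intros)
  moreover have "0 \<in> T" using \<open>a \<in> U\<close> by (simp add: T_def)
  ultimately obtain e where "e > 0" "cball 0 e \<subseteq> T" using open_contains_cball by blast
  then have "{-e..e} \<subseteq> T" by (simp add: cball_eq_atLeastAtMost)
  moreover have "infinite {-e..e}" using \<open>e > 0\<close> by (intro infinite_Icc) simp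
  ultimately have "infinite T" using finite_subset by blast
  moreover have "poly p (of_real t) = 0" if "t \<in> T" for t
    using that 0 unfolding p[symmetric] by (auto simp: T_def)
  ultimately have "p = 0" by (rule poly_eq_0_if_zero_on_infinite_reals)
  then show ?thesis using p[of 1] by simp
qed

text \<open>On the line from a point good for \<open>j\<close> to a point good for all of
  \<open>I\<close>, every member restricts to a nonzero univariate polynomial, and so does the
  product.\<close>

lemma cpoly_fun_common_nonzero:
  assumes "finite I" "\<And>i. i \<in> I \<Longrightarrow> cpoly_fun (f i)" "\<And>i. i \<in> I \<Longrightarrow> \<exists>x. f i x \<noteq> 0"
  shows "\<exists>x. \<forall>i\<in>I. f i x \<noteq> 0"
  using assms
proof (induction I rule: finite_induct)
  case (insert j I)
  obtain y where y: "\<forall>i\<in>I. f i y \<noteq> 0" using insert by auto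
  obtain x where x: "f j x \<noteq> 0" using insert.prems by auto
  have "\<forall>i. \<exists>p. i \<in> insert j I \<longrightarrow> (\<forall>t::real. f i (x + t *\<^sub>R (y - x)) = poly p (of_real t))"
    using insert.prems(1) cpoly_fun_line by metis
  then obtain p where p: "\<And>i t. i \<in> insert j I \<Longrightarrow> f i (x + t *\<^sub>R (y - x)) = poly (p i) (complex_of_real t)"
    by metis
  have "p j \<noteq> 0" using x p[of j 0] by auto
  moreover have "p i \<noteq> 0" if "i \<in> I" for i using y that p[of i 1] by auto
  ultimately have "(\<Prod>i\<in>insert j I. p i) \<noteq> 0" using insert.hyps by auto
  then obtain t where "poly (\<Prod>i\<in>insert j I. p i) (complex_of_real t) \<noteq> 0"
    using poly_eq_0_if_zero_on_infinite_reals[of UNIV] infinite_UNIV_char_0 by blast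
  then have "\<forall>i\<in>insert j I. f i (x + t *\<^sub>R (y - x)) \<noteq> 0"
    using p insert.hyps by (auto simp: poly_prod)
  then show ?case by blast
qed auto

lemma cpoly_fun_common_nonzero_open:
  assumes "finite I" "\<And>i. i \<in> I \<Longrightarrow> cpoly_fun (f i)" "\<And>i. i \<in> I \<Longrightarrow> \<exists>x. f i x \<noteq> 0"
    and "open U" "U \<noteq> {}"
  shows "\<exists>x\<in>U. \<forall>i\<in>I. f i x \<noteq> 0"
proof (rule ccontr)
  assume "\<not> ?thesis"
  then have "(\<Prod>i\<in>I. f i x) = 0" if "x \<in> U" for x using that \<open>finite I\<close> by auto
  then have "(\<Prod>i\<in>I. f i x) = 0" for x
    using cpoly_fun_eq_0_if_zero_on_open[of "\<lambda>x. \<Prod>i\<in>I. f i x" U] assms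
    by (metis cpoly_fun_prod equals0I)
  then show False using cpoly_fun_common_nonzero[of I f] assms(1-3) by (metis prod_zero_iff)
qed

section \<open>Exponential sums with rational exponents in several variables\<close>

lemma exponential_sum_coefficients_zero:
  fixes P :: "real^'m \<Rightarrow> real^'n"
  assumes P: "\<And>i. cpoly_fun (\<lambda>x. of_real (P x $ i))" and W: "cpoly_fun (\<lambda>x. of_real (W x))"
    and U: "open U" "\<And>t. t \<in> U \<Longrightarrow> W t \<noteq> 0"
    and hyp: "\<And>a b. a \<noteq> 0 \<Longrightarrow> \<exists>t. a \<bullet> P t \<noteq> b * W t"
    and V: "finite V" "\<And>v. v \<in> V \<Longrightarrow> cpoly_fun (N v)"
    and sum0: "\<And>t. t \<in> U \<Longrightarrow> (\<Sum>v\<in>V. N v t * exp (- \<i> * of_real (v \<bullet> P t / W t))) = 0"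
    and "v0 \<in> V" "t0 \<in> U"
  shows "N v0 t0 = 0"
proof -
  \<comment> \<open>Restrict to a segment from \<open>t0\<close> to a nearby \<open>t1\<close> along which no difference of two exponents
    is constant; such \<open>t1\<close> exists by \<open>hyp\<close>.\<close>
  obtain e where e: "e > 0" "ball t0 e \<subseteq> U" using \<open>t0 \<in> U\<close> U(1) open_contains_ball by blast
  \<comment> \<open>If two exponents differed by a constant along a segment starting at
    \<open>t0\<close>, this value would be that constant, up to the factor
    \<open>- \<i>\<close>.\<close>
  define c where "c v w = (v - w) \<bullet> P t0 / W t0" for v w
  define h where "h = (\<lambda>(v, w) x. complex_of_real ((v - w) \<bullet> P x - c v w * W x))"
  define I where "I = {(v, w). v \<in> V \<and> w \<in> V \<and> v \<noteq> w}"
  have "\<exists>x\<in>ball t0 e. \<forall>i\<in>I. h i x \<noteq> 0"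
  proof (rule cpoly_fun_common_nonzero_open)
    have "I \<subseteq> V \<times> V" by (auto simp: I_def)
    then show "finite I" using V(1) finite_subset by blast
    show "cpoly_fun (h i)" if "i \<in> I" for i
      unfolding h_def case_prod_unfold of_real_diff of_real_mult
      by (intro cpoly_fun_diff cpoly_fun_inner_compose cpoly_fun.mult cpoly_fun.const P W)
    show "\<exists>x. h i x \<noteq> 0" if "i \<in> I" for i
      using that hyp[of "fst i - snd i" "c (fst i) (snd i)"]
      by (auto simp: I_def h_def case_prod_unfold simp flip: of_real_mult of_real_diff)
  qed (use e in auto)
  then obtain t1 where t1: "t1 \<in> ball t0 e" "\<And>v w. v \<in> V \<Longrightarrow> w \<in> V \<Longrightarrow> v \<noteq> w \<Longrightarrow> (v - w) \<bullet> P t1 \<noteq> c v w * W t1"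
    by (auto simp: I_def h_def simp flip: of_real_mult of_real_diff)
  define l where "l r = t0 + r *\<^sub>R (t1 - t0)" for r
  have lU: "l r \<in> U" if "0 \<le> r" "r \<le> 1" for r
  proof -
    have "l r = (1 - r) *\<^sub>R t0 + r *\<^sub>R t1" by (simp add: l_def algebra_simps)
    also have "\<dots> \<in> ball t0 e"
      using that e t1 by (intro convexD[OF convex_ball]) auto
    finally show ?thesis using e by blast
  qed
  obtain pw where pw: "\<And>r::real. complex_of_real (W (l r)) = poly pw (of_real r)"
    unfolding l_def using cpoly_fun_line[OF W] by blast
  have "\<forall>v. \<exists>p. \<forall>r::real. - \<i> * of_real (v \<bullet> P (l r)) = poly p (of_real r)"
  proof
    fix v
    have "cpoly_fun (\<lambda>x. - \<i> * of_real (v \<bullet> P x))"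
      by (intro cpoly_fun.mult cpoly_fun.const cpoly_fun_inner_compose P)
    then show "\<exists>p. \<forall>r::real. - \<i> * of_real (v \<bullet> P (l r)) = poly p (of_real r)"
      unfolding l_def using cpoly_fun_line by metis
  qed
  then obtain pu where pu: "\<And>v r. - \<i> * of_real (v \<bullet> P (l r)) = poly (pu v) (of_real r)" by metis
  have "\<forall>v. \<exists>p. v \<in> V \<longrightarrow> (\<forall>r::real. N v (l r) = poly p (of_real r))"
    unfolding l_def using V(2) cpoly_fun_line by metis
  then obtain pN where pN: "\<And>v r. v \<in> V \<Longrightarrow> N v (l r) = poly (pN v) (of_real r)" by metis
  have "\<forall>v\<in>V. pN v = 0"
  proof (rule exp_rational_independent[where u = pu and w = pw and a = 0 and b = 1])
    fix r :: real assume r: "r \<in> {0<..<1}"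
    then have "W (l r) \<noteq> 0" using U(2) lU by auto
    then show "poly pw (of_real r) \<noteq> 0" unfolding pw[symmetric] by simp
    have "(\<Sum>v\<in>V. N v (l r) * exp (- \<i> * of_real (v \<bullet> P (l r) / W (l r)))) = 0"
      using r by (intro sum0 lU) auto
    then show "(\<Sum>v\<in>V. poly (pN v) (of_real r) * exp (poly (pu v) (of_real r) / poly pw (of_real r))) = 0"
      by (simp add: pN pu[symmetric] pw[symmetric])
  next
    fix v w assume vw: "v \<in> V" "w \<in> V" "v \<noteq> w"
    show "\<nexists>k. pu v - pu w = smult k pw"
    proof
      assume "\<exists>k. pu v - pu w = smult k pw"
      then obtain k where "pu v - pu w = smult k pw" ..
      then have "poly (pu v) (of_real r) - poly (pu w) (of_real r) = k * poly pw (of_real r)" for r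
        by (metis poly_diff poly_smult)
      then have k: "- \<i> * of_real ((v - w) \<bullet> P (l r)) = k * of_real (W (l r))" for r
        by (simp add: pu[symmetric] pw[symmetric] inner_diff_left algebra_simps)
      have "k = - \<i> * of_real (c v w)"
        using k[of 0] U(2)[OF \<open>t0 \<in> U\<close>] by (simp add: l_def c_def field_simps)
      then have "- \<i> * of_real ((v - w) \<bullet> P t1) = - \<i> * of_real (c v w * W t1)"
        using k[of 1] by (simp add: l_def)
      then have "(v - w) \<bullet> P t1 = c v w * W t1"
        by (simp only: mult_cancel_left of_real_eq_iff) simp
      then show False using t1(2) vw by blast
    qed
  qed (use V in auto)
  \<comment> \<open>The relation was used on the open segment only, but the coefficients vanish as
    polynomials, hence also at parameter 0, which is \<open>t0\<close>.\<close>
  then show ?thesis using pN[OF \<open>v0 \<in> V\<close>, of 0] \<open>v0 \<in> V\<close> by (simp add: l_def)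
qed

section \<open>Fourier integrals over simplices\<close>

text \<open>The degree is an explicit index and the zero function has every degree, so frequencies
  missing from a sum can be given the numerator 0.\<close>

definition homogeneous_poly :: "nat \<Rightarrow> (real^'n \<Rightarrow> complex) \<Rightarrow> bool" where
  "homogeneous_poly l f \<longleftrightarrow> cpoly_fun f \<and> (\<forall>c x. f (c *\<^sub>R x) = of_real c ^ l * f x)"

lemma homogeneous_poly_const: "homogeneous_poly 0 (\<lambda>x. c)"
  by (simp add: homogeneous_poly_def cpoly_fun.const)

lemma homogeneous_poly_zero: "homogeneous_poly l (\<lambda>x. 0)"
  by (simp add: homogeneous_poly_def cpoly_fun.const)

lemma homogeneous_poly_linear: "homogeneous_poly 1 (\<lambda>s. c * of_real (v \<bullet> s))"
  by (auto simp: homogeneous_poly_def intro!: cpoly_fun.mult cpoly_fun.const cpoly_fun_inner_compose cpoly_fun.coord)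

lemma homogeneous_poly_add:
  "homogeneous_poly l f \<Longrightarrow> homogeneous_poly l g \<Longrightarrow> homogeneous_poly l (\<lambda>x. f x + g x)"
  by (auto simp: homogeneous_poly_def algebra_simps intro: cpoly_fun.add)

lemma homogeneous_poly_mult:
  "homogeneous_poly k f \<Longrightarrow> homogeneous_poly l g \<Longrightarrow> homogeneous_poly (k + l) (\<lambda>x. f x * g x)"
  by (auto simp: homogeneous_poly_def algebra_simps power_add intro: cpoly_fun.mult)

lemma homogeneous_poly_uminus: "homogeneous_poly l f \<Longrightarrow> homogeneous_poly l (\<lambda>x. - f x)"
  using homogeneous_poly_mult[OF homogeneous_poly_const[of "-1"], of l f] by simp

lemma homogeneous_poly_sum:
  "(\<And>i. i \<in> I \<Longrightarrow> homogeneous_poly l (f i)) \<Longrightarrow> homogeneous_poly l (\<lambda>x. \<Sum>i\<in>I. f i x)"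
  by (induction I rule: infinite_finite_induct) (auto intro: homogeneous_poly_zero homogeneous_poly_add)

lemma homogeneous_poly_prod:
  assumes "finite I" "\<And>i. i \<in> I \<Longrightarrow> homogeneous_poly (d i) (f i)"
  shows "homogeneous_poly (sum d I) (\<lambda>x. \<Prod>i\<in>I. f i x)"
  using assms by (induction I rule: finite_induct) (auto intro: homogeneous_poly_const homogeneous_poly_mult)

lemma cpoly_fun_mult_nonzero:
  assumes "cpoly_fun f" "cpoly_fun g" "f x \<noteq> 0" "g y \<noteq> 0"
  shows "\<exists>z. f z * g z \<noteq> 0"
proof -
  have "\<exists>z. \<forall>b\<in>UNIV. (if b then f else g) z \<noteq> 0"
    by (rule cpoly_fun_common_nonzero) (use assms in auto)
  then obtain z where z: "\<And>b. (if b then f else g) z \<noteq> 0" by blast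
  from z[of True] z[of False] show ?thesis by auto
qed

section \<open>Fourier integrals over corner simplices by slicing\<close>

definition corner_simplex :: "'i set \<Rightarrow> real \<Rightarrow> ('i \<Rightarrow> real) set" where
  "corner_simplex A r = {x. (\<forall>i\<in>A. 0 \<le> x i) \<and> sum x A \<le> r}"

text \<open>The Fourier integral of a corner simplex at the frequency \<open>z\<close>. Points are
  functions on an index set, so that coordinates can be added one at a time.\<close>

definition corner_fourier :: "'i set \<Rightarrow> real \<Rightarrow> ('i \<Rightarrow> real) \<Rightarrow> complex" where
  "corner_fourier A r z = (\<integral>x. indicator (corner_simplex A r) x *\<^sub>R exp (- \<i> * of_real (\<Sum>i\<in>A. x i * z i))
      \<partial>Pi\<^sub>M A (\<lambda>_. lborel))"

lemma corner_simplex_insert: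
  assumes "b \<notin> A" "finite A"
  shows "x(b := y) \<in> corner_simplex (insert b A) r \<longleftrightarrow> y \<in> {0..r} \<and> x \<in> corner_simplex A (r - y)"
proof -
  have 1: "(\<forall>i\<in>insert b A. 0 \<le> (x(b := y)) i) \<longleftrightarrow> 0 \<le> y \<and> (\<forall>i\<in>A. 0 \<le> x i)"
    using assms by auto
  have "sum (x(b := y)) A = sum x A" using assms by (intro sum.cong) auto
  then have 2: "sum (x(b := y)) (insert b A) = y + sum x A" using assms by simp
  show ?thesis
  proof (cases "\<forall>i\<in>A. 0 \<le> x i")
    case True
    then have "sum x A \<ge> 0" by (simp add: sum_nonneg)
    then show ?thesis unfolding corner_simplex_def mem_Collect_eq 1 2 by auto
  next
    case False
    then show ?thesis unfolding corner_simplex_def mem_Collect_eq 1 2 by blast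
  qed
qed

lemma corner_fourier_integrable:
  assumes "finite A" "r \<ge> 0"
  shows "integrable (Pi\<^sub>M A (\<lambda>_. lborel)) (\<lambda>x. indicator (corner_simplex A r) x *\<^sub>R exp (- \<i> * of_real (\<Sum>i\<in>A. x i * z i)))"
proof -
  let ?M = "Pi\<^sub>M A (\<lambda>_. lborel :: real measure)"
  let ?S = "corner_simplex A r \<inter> space ?M"
  \<comment> \<open>Values outside \<open>A\<close> are unconstrained in
    \<open>corner_simplex\<close>; intersecting with the space of the product measure gives a
    measurable set, which has finite measure by the volume formula for the simplex.\<close>
  have "?S = Pi\<^sub>E A (\<lambda>_. {0..}) \<inter> (\<lambda>x. sum x A) -` {..r} \<inter> space ?M"
    by (auto simp: corner_simplex_def space_PiM)
  also have "\<dots> \<in> sets ?M" using \<open>finite A\<close> by measurable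
  finally have S[measurable]: "?S \<in> sets ?M" .
  have E: "emeasure ?M ?S < \<infinity>"
    using emeasure_std_simplex_aux[OF assms] by (simp add: corner_simplex_def ennreal_divide_eq_top_iff less_top)
  have "integrable ?M (\<lambda>x. indicator ?S x *\<^sub>R exp (- \<i> * of_real (\<Sum>i\<in>A. x i * z i)))"
  proof (rule integrableI_bounded_set[where A = ?S and B = 1])
    show "(\<lambda>x. indicator ?S x *\<^sub>R exp (- \<i> * complex_of_real (\<Sum>i\<in>A. x i * z i))) \<in> borel_measurable ?M"
      by measurable
  qed (use S E in \<open>auto simp: indicator_def norm_exp_eq_Re\<close>)
  also have "?this \<longleftrightarrow> ?thesis"
    by (intro Bochner_Integration.integrable_cong) (auto simp: indicator_def)
  finally show ?thesis .
qed

text \<open>Fubini with the new coordinate outermost, the form in which a simplex is cut into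
  slices.\<close>

lemma integral_PiM_insert:
  fixes f :: "('i \<Rightarrow> real) \<Rightarrow> complex"
  assumes A: "finite A" "b \<notin> A" and f: "integrable (Pi\<^sub>M (insert b A) (\<lambda>_. lborel)) f"
  shows "integral\<^sup>L (Pi\<^sub>M (insert b A) (\<lambda>_. lborel)) f =
    (\<integral>y. (\<integral>x. f (x(b := y)) \<partial>Pi\<^sub>M A (\<lambda>_. lborel)) \<partial>lborel)"
proof -
  interpret product_sigma_finite "\<lambda>_ :: 'i. lborel :: real measure" by standard
  interpret F: finite_product_sigma_finite "\<lambda>_ :: 'i. lborel :: real measure" A by standard fact
  have fm: "f \<in> borel_measurable (Pi\<^sub>M (insert b A) (\<lambda>_. lborel))" using f by auto
  have "(\<lambda>p. (snd p)(b := fst p)) \<in> measurable (lborel \<Otimes>\<^sub>M Pi\<^sub>M A (\<lambda>_. lborel)) (Pi\<^sub>M (insert b A) (\<lambda>_. lborel :: real measure))"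
    by (rule measurable_fun_upd[where J = A]) auto
  then have "(\<lambda>p. f ((snd p)(b := fst p))) \<in> borel_measurable (lborel \<Otimes>\<^sub>M Pi\<^sub>M A (\<lambda>_. lborel))"
    by (rule measurable_compose[OF _ fm])
  then have meas: "(\<lambda>y. \<integral>x. f (x(b := y)) \<partial>Pi\<^sub>M A (\<lambda>_. lborel)) \<in> borel_measurable lborel"
    by (intro F.borel_measurable_lebesgue_integral) (simp add: split_beta')
  have "integral\<^sup>L (Pi\<^sub>M (insert b A) (\<lambda>_. lborel)) f = integral\<^sup>L (Pi\<^sub>M ({b} \<union> A) (\<lambda>_. lborel)) f" by simp
  also have "\<dots> = (\<integral>x. (\<integral>y. f (merge {b} A (x,y)) \<partial>Pi\<^sub>M A (\<lambda>_. lborel)) \<partial>Pi\<^sub>M {b} (\<lambda>_. lborel))"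
    using A f by (intro product_integral_fold) auto
  also have "\<dots> = (\<integral>x. (\<integral>y. f (y(b := x b)) \<partial>Pi\<^sub>M A (\<lambda>_. lborel)) \<partial>Pi\<^sub>M {b} (\<lambda>_. lborel))"
  proof (intro Bochner_Integration.integral_cong refl arg_cong[where f = f])
    fix x y :: "'i \<Rightarrow> real" assume "y \<in> space (Pi\<^sub>M A (\<lambda>_. lborel))"
    then show "merge {b} A (x,y) = y(b := x b)"
      using A by (auto simp: merge_def space_PiM PiE_def extensional_def fun_eq_iff)
  qed
  also have "\<dots> = (\<integral>y. (\<integral>x. f (x(b := y)) \<partial>Pi\<^sub>M A (\<lambda>_. lborel)) \<partial>lborel)"
    using product_integral_singleton[OF meas] by simp
  finally show ?thesis .
qed

lemma corner_fourier_insert: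
  assumes A: "finite A" "b \<notin> A" and "r \<ge> 0"
  shows "corner_fourier (insert b A) r z =
    (\<integral>y. indicator {0..r} y *\<^sub>R (exp (- \<i> * of_real (y * z b)) * corner_fourier A (r - y) z) \<partial>lborel)"
proof -
  have "corner_fourier (insert b A) r z = (\<integral>y. (\<integral>x. indicator (corner_simplex (insert b A) r) (x(b := y)) *\<^sub>R
      exp (- \<i> * of_real (\<Sum>i\<in>insert b A. (x(b := y)) i * z i)) \<partial>Pi\<^sub>M A (\<lambda>_. lborel)) \<partial>lborel)"
    unfolding corner_fourier_def
    using assms by (intro integral_PiM_insert corner_fourier_integrable) auto
  also have "\<dots> = (\<integral>y. (\<integral>x. (indicator {0..r} y *\<^sub>R exp (- \<i> * of_real (y * z b))) * (indicator (corner_simplex A (r - y)) x *\<^sub>R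
      exp (- \<i> * of_real (\<Sum>i\<in>A. x i * z i))) \<partial>Pi\<^sub>M A (\<lambda>_. lborel)) \<partial>lborel)"
  proof (intro Bochner_Integration.integral_cong refl)
    fix x y
    have "(\<Sum>i\<in>A. (x(b := y)) i * z i) = (\<Sum>i\<in>A. x i * z i)"
      using A by (intro sum.cong) auto
    then have "(\<Sum>i\<in>insert b A. (x(b := y)) i * z i) = y * z b + (\<Sum>i\<in>A. x i * z i)"
      using A by simp
    then have e: "exp (- \<i> * of_real (\<Sum>i\<in>insert b A. (x(b := y)) i * z i)) =
      exp (- \<i> * of_real (y * z b)) * exp (- \<i> * of_real (\<Sum>i\<in>A. x i * z i))"
      by (simp add: exp_add[symmetric] algebra_simps)
    show "indicator (corner_simplex (insert b A) r) (x(b := y)) *\<^sub>R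
      exp (- \<i> * of_real (\<Sum>i\<in>insert b A. (x(b := y)) i * z i)) =
      (indicator {0..r} y *\<^sub>R exp (- \<i> * of_real (y * z b))) * (indicator (corner_simplex A (r - y)) x *\<^sub>R
      exp (- \<i> * of_real (\<Sum>i\<in>A. x i * z i)))"
      unfolding e using corner_simplex_insert[OF A(2,1), of x y r] by (auto simp: indicator_def)
  qed
  also have "\<dots> = (\<integral>y. indicator {0..r} y *\<^sub>R (exp (- \<i> * of_real (y * z b)) * corner_fourier A (r - y) z) \<partial>lborel)"
    unfolding corner_fourier_def integral_mult_right_zero by simp
  finally show ?thesis .
qed

text \<open>Used with \<beta> = \<open>w b \<bullet> s\<close> and \<gamma> =
  \<open>v \<bullet> s\<close>. Keeping the linear factor on the left instead of dividing by it
  covers the case of equal frequencies, where both sides are 0.\<close>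

lemma integral_exp_affine:
  fixes \<beta> \<gamma> r :: real
  assumes "r \<ge> 0"
  shows "integrable lborel (\<lambda>y. indicator {0..r} y *\<^sub>R exp (- \<i> * of_real (y * \<beta> + (r - y) * \<gamma>)))" (is "integrable _ ?f")
    and "- \<i> * of_real (\<beta> - \<gamma>) * (\<integral>y. indicator {0..r} y *\<^sub>R exp (- \<i> * of_real (y * \<beta> + (r - y) * \<gamma>)) \<partial>lborel)
      = exp (- \<i> * of_real (r * \<beta>)) - exp (- \<i> * of_real (r * \<gamma>))"
proof -
  let ?g = "\<lambda>y. exp (- \<i> * complex_of_real (y * \<beta> + (r - y) * \<gamma>))"
  show "integrable lborel ?f"
    by (rule borel_integrable_compact) (auto intro!: continuous_intros)
  have "((\<lambda>z. exp (- \<i> * (z * of_real \<beta> + (of_real r - z) * of_real \<gamma>))) has_field_derivative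
      ?g y * (- \<i> * of_real (\<beta> - \<gamma>))) (at (of_real y))" for y
    by (rule derivative_eq_intros refl | simp add: algebra_simps)+
  then have der: "(?g has_vector_derivative ?g y * (- \<i> * of_real (\<beta> - \<gamma>))) (at y within S)" for y S
    using has_vector_derivative_real_field has_vector_derivative_at_within by fastforce
  have "(\<integral>y. indicator {0..r} y *\<^sub>R (?g y * (- \<i> * of_real (\<beta> - \<gamma>))) \<partial>lborel) = ?g r - ?g 0"
    using assms by (intro integral_FTC_Icc der) (auto intro!: continuous_intros)
  then have "(\<integral>y. (- \<i> * of_real (\<beta> - \<gamma>)) * (indicator {0..r} y *\<^sub>R ?g y) \<partial>lborel) = ?g r - ?g 0"
    by (simp add: mult_ac)
  then show "- \<i> * of_real (\<beta> - \<gamma>) * (\<integral>y. indicator {0..r} y *\<^sub>R ?g y \<partial>lborel)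
      = exp (- \<i> * of_real (r * \<beta>)) - exp (- \<i> * of_real (r * \<gamma>))"
    unfolding integral_mult_right_zero by simp
qed

text \<open>The size \<open>r\<close> is kept as a parameter since slicing along one coordinate changes the size of the
  remaining simplex.\<close>
lemma corner_fourier_exponential_sum:
  fixes w :: "'i \<Rightarrow> real^'n"
  assumes "finite A" "inj_on w A" "0 \<notin> w ` A"
  shows "\<exists>l Q N. homogeneous_poly (l + card A) Q \<and> (\<exists>s. Q s \<noteq> 0) \<and> (\<forall>v. homogeneous_poly l (N v)) \<and>
    (\<forall>s. \<forall>r\<ge>0. Q s * corner_fourier A r (\<lambda>i. w i \<bullet> s) =
      (\<Sum>v\<in>insert 0 (w ` A). N v s * exp (- \<i> * of_real (r * (v \<bullet> s)))))"
  using assms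
proof (induction A rule: finite_induct)
  case empty
  have "corner_fourier {} r z = 1" if "r \<ge> 0" for r and z :: "'i \<Rightarrow> real"
    using that unfolding corner_fourier_def by (simp add: PiM_empty lebesgue_integral_count_space_finite corner_simplex_def)
  then show ?case
    by (intro exI[of _ 0] exI[of _ "\<lambda>_. 1"] exI[of _ "\<lambda>_ _. 1"]) (auto simp: homogeneous_poly_const)
next
  case (insert b A)
  then obtain l Q N where Q: "homogeneous_poly (l + card A) Q" "\<exists>s. Q s \<noteq> 0"
    and N: "\<And>v. homogeneous_poly l (N v)"
    and K: "\<And>s r. r \<ge> 0 \<Longrightarrow> Q s * corner_fourier A r (\<lambda>i. w i \<bullet> s) =
      (\<Sum>v\<in>insert 0 (w ` A). N v s * exp (- \<i> * of_real (r * (v \<bullet> s))))"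
    by auto
  define V where "V = insert 0 (w ` A)"
  have V: "finite V" "w b \<notin> V" using insert by (auto simp: V_def inj_on_def)
  \<comment> \<open>The vertex \<open>0\<close> counts too: \<open>card A + 1\<close> linear factors
    enter the denominator, but each numerator gains only \<open>card A\<close> of them, so the
    degree gap grows by one.\<close>
  have "card V = Suc (card A)"
    using insert by (simp add: V_def card_image inj_on_def)
  define L where "L v s = - \<i> * of_real ((w b - v) \<bullet> s)" for v s
  have L: "homogeneous_poly 1 (L v)" for v unfolding L_def[abs_def] by (rule homogeneous_poly_linear)
  define M where "M v s = N v s * (\<Prod>u\<in>V - {v}. L u s)" for v s
  have M: "homogeneous_poly (l + card A) (M v)" if "v \<in> V" for v
    unfolding M_def[abs_def]
    using homogeneous_poly_mult[OF N homogeneous_poly_prod[of "V - {v}" "\<lambda>_. 1" L]] L V that \<open>card V = _\<close> by simp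
  define Q' where "Q' s = Q s * (\<Prod>u\<in>V. L u s)" for s
  \<comment> \<open>Integrating over the slice height \<open>y\<close> produces boundary terms:
    \<open>y = r\<close> contributes every \<open>M v\<close> to the new vertex \<open>w b\<close>,
    and \<open>y = 0\<close> contributes \<open>- M v\<close> to the old vertex
    \<open>v\<close>.\<close>
  define N' where "N' v = (if v \<in> V then (\<lambda>s. - M v s) else if v = w b then (\<lambda>s. \<Sum>v\<in>V. M v s) else (\<lambda>s. 0))" for v
  have "homogeneous_poly (l + card A + card V) Q'"
    unfolding Q'_def[abs_def]
    using homogeneous_poly_mult[OF Q(1) homogeneous_poly_prod[of V "\<lambda>_. 1" L]] L V by simp
  then have Q'1: "homogeneous_poly (l + card A + card (insert b A)) Q'" using insert \<open>card V = _\<close> by simp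
  have "\<exists>s. (\<Prod>u\<in>V. L u s) \<noteq> 0"
  proof -
    have "\<exists>s. L v s \<noteq> 0" if "v \<in> V" for v
      using that V(2) by (intro exI[of _ "w b - v"]) (auto simp: L_def)
    then have "\<exists>s. \<forall>u\<in>V. L u s \<noteq> 0"
      using cpoly_fun_common_nonzero[of V L] V(1) L by (auto simp: homogeneous_poly_def)
    then show ?thesis using V(1) by (auto)
  qed
  moreover have "cpoly_fun (\<lambda>s. \<Prod>u\<in>V. L u s)" using L by (auto intro!: cpoly_fun_prod simp: homogeneous_poly_def)
  ultimately have Q'2: "\<exists>s. Q' s \<noteq> 0"
    unfolding Q'_def using cpoly_fun_mult_nonzero[of Q] Q by (auto simp: homogeneous_poly_def)
  have N': "homogeneous_poly (l + card A) (N' v)" for v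
    unfolding N'_def by (auto intro!: homogeneous_poly_uminus homogeneous_poly_sum M homogeneous_poly_zero)
  have "Q' s * corner_fourier (insert b A) r (\<lambda>i. w i \<bullet> s) =
      (\<Sum>v\<in>insert 0 (w ` insert b A). N' v s * exp (- \<i> * of_real (r * (v \<bullet> s))))" if r: "r \<ge> 0" for s r
  proof -
    define E where "E v = exp (- \<i> * of_real (r * (v \<bullet> s)))" for v
    define J where "J v = (\<integral>y. indicator {0..r} y *\<^sub>R exp (- \<i> * of_real (y * (w b \<bullet> s) + (r - y) * (v \<bullet> s))) \<partial>lborel)" for v
    have LJ: "L v s * J v = E (w b) - E v" for v
      using integral_exp_affine(2)[OF r, of "w b \<bullet> s" "v \<bullet> s"] by (simp add: L_def J_def E_def inner_diff_left)
    have "Q s * corner_fourier (insert b A) r (\<lambda>i. w i \<bullet> s) =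
      (\<integral>y. Q s * (indicator {0..r} y *\<^sub>R (exp (- \<i> * of_real (y * (w b \<bullet> s))) * corner_fourier A (r - y) (\<lambda>i. w i \<bullet> s))) \<partial>lborel)"
      unfolding integral_mult_right_zero corner_fourier_insert[OF insert.hyps r] by simp
    also have "\<dots> = (\<integral>y. (\<Sum>v\<in>V. N v s * (indicator {0..r} y *\<^sub>R exp (- \<i> * of_real (y * (w b \<bullet> s) + (r - y) * (v \<bullet> s))))) \<partial>lborel)"
    proof (intro Bochner_Integration.integral_cong refl)
      fix y
      show "Q s * (indicator {0..r} y *\<^sub>R (exp (- \<i> * of_real (y * (w b \<bullet> s))) * corner_fourier A (r - y) (\<lambda>i. w i \<bullet> s)))
        = (\<Sum>v\<in>V. N v s * (indicator {0..r} y *\<^sub>R exp (- \<i> * of_real (y * (w b \<bullet> s) + (r - y) * (v \<bullet> s)))))"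
      proof (cases "y \<in> {0..r}")
        case True
        have eadd: "exp (- \<i> * of_real x) * (c * exp (- \<i> * of_real x')) = c * exp (- \<i> * of_real (x + x'))" for c x x'
          by (simp add: exp_add[symmetric] algebra_simps)
        from True have "exp (- \<i> * of_real (y * (w b \<bullet> s))) * (Q s * corner_fourier A (r - y) (\<lambda>i. w i \<bullet> s)) =
          (\<Sum>v\<in>V. N v s * exp (- \<i> * of_real (y * (w b \<bullet> s) + (r - y) * (v \<bullet> s))))"
          by (subst K) (simp_all only: V_def[symmetric] sum_distrib_left eadd, simp)
        with True show ?thesis by (simp add: mult.left_commute)
      qed auto
    qed
    also have "\<dots> = (\<Sum>v\<in>V. N v s * J v)"
    proof (subst Bochner_Integration.integral_sum)
      fix v
      show "integrable lborel (\<lambda>y. N v s * (indicator {0..r} y *\<^sub>R exp (- \<i> * of_real (y * (w b \<bullet> s) + (r - y) * (v \<bullet> s)))))"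
        by (intro integrable_mult_right integral_exp_affine(1)[OF r])
    qed (simp only: integral_mult_right_zero J_def)
    finally have "Q' s * corner_fourier (insert b A) r (\<lambda>i. w i \<bullet> s) = (\<Prod>u\<in>V. L u s) * (\<Sum>v\<in>V. N v s * J v)"
      by (simp add: Q'_def mult_ac)
    also have "\<dots> = (\<Sum>v\<in>V. M v s * (L v s * J v))"
      unfolding sum_distrib_left
    proof (rule sum.cong)
      fix v assume "v \<in> V"
      then have "(\<Prod>u\<in>V. L u s) = L v s * (\<Prod>u\<in>V - {v}. L u s)" by (rule prod.remove[OF V(1)])
      then show "(\<Prod>u\<in>V. L u s) * (N v s * J v) = M v s * (L v s * J v)" by (simp add: M_def)
    qed simp
    also have "\<dots> = (\<Sum>v\<in>V. N' v s * E v) + N' (w b) s * E (w b)"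
    proof -
      have "(\<Sum>v\<in>V. M v s * (E (w b) - E v)) = (\<Sum>v\<in>V. - M v s * E v) + (\<Sum>v\<in>V. M v s) * E (w b)"
        by (simp add: right_diff_distrib sum_subtractf sum_distrib_right sum_negf)
      also have "(\<Sum>v\<in>V. - M v s * E v) = (\<Sum>v\<in>V. N' v s * E v)"
        by (intro sum.cong) (auto simp: N'_def)
      also have "(\<Sum>v\<in>V. M v s) = N' (w b) s" using V(2) by (simp add: N'_def)
      finally show ?thesis unfolding LJ .
    qed
    also have "\<dots> = (\<Sum>v\<in>insert (w b) V. N' v s * E v)" using V by simp
    also have "insert (w b) V = insert 0 (w ` insert b A)" by (auto simp: V_def)
    finally show ?thesis by (simp add: E_def)
  qed
  with Q'1 Q'2 N' show ?case
    by (intro exI[of _ "l + card A"] exI[of _ Q'] exI[of _ N'] conjI allI impI)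
qed

section \<open>Linear change of variables for Lebesgue measure\<close>

lemma nn_integral_lborel_translate:
  fixes c :: "'a::euclidean_space"
  assumes "f \<in> borel_measurable borel"
  shows "(\<integral>\<^sup>+x. f (c + x) \<partial>lborel) = (\<integral>\<^sup>+x. f x \<partial>lborel)"
proof -
  have "(\<integral>\<^sup>+x. f x \<partial>lborel) = (\<integral>\<^sup>+x. f x \<partial>distr lborel borel ((+) c))"
    by (simp add: lborel_distr_plus)
  also have "\<dots> = (\<integral>\<^sup>+x. f (c + x) \<partial>lborel)"
    using assms by (subst nn_integral_distr) auto
  finally show ?thesis ..
qed

text \<open>Uniqueness of Haar measure by the usual double-integral trick. The determinant formula of the
  library needs a well-ordered index type, which \<open>'m option\<close> is not; the constant is irrelevant below.\<close>
lemma distr_lborel_linear: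
  fixes M :: "'a::euclidean_space \<Rightarrow> 'a"
  assumes "linear M" "bij M"
  shows "\<exists>k::real. k \<ge> 0 \<and> distr lborel borel M = density lborel (\<lambda>_. ennreal k)"
proof -
  \<comment> \<open>The indicator of the unit ball is a test function with integral strictly between
    0 and infinity; comparison with it determines the constant as \<open>C / a\<close>.\<close>
  define g :: "'a \<Rightarrow> ennreal" where "g = indicator (ball 0 1)"
  define C where "C = (\<integral>\<^sup>+x. g (- M x) \<partial>lborel)"
  define a where "a = (\<integral>\<^sup>+x. g x \<partial>lborel)"
  have [measurable]: "g \<in> borel_measurable borel" unfolding g_def by (intro borel_measurable_indicator borel_open open_ball)
  have [measurable]: "M \<in> borel_measurable borel"
    using assms(1) by (intro borel_measurable_continuous_onI linear_continuous_on linear_conv_bounded_linear[THEN iffD1])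
  have a: "a = ennreal (measure lborel (ball (0::'a) 1))"
    unfolding a_def g_def
    using emeasure_lborel_ball_finite[of "0::'a" 1]
    by (subst nn_integral_indicator) (auto simp: emeasure_eq_ennreal_measure less_top)
  have a0: "measure lborel (ball (0::'a) 1) > 0" by (simp add: content_ball_pos)
  \<comment> \<open>An injective linear map is bounded below, so \<open>g (- M x)\<close> vanishes
    outside a ball and \<open>C\<close> is finite.\<close>
  obtain B where B: "B > 0" "\<And>x. B * norm x \<le> norm (M x)"
    using linear_inj_bounded_below_pos[OF assms(1)] assms(2) bij_is_inj by blast
  have "C \<le> (\<integral>\<^sup>+x. indicator (cball (0::'a) (1 / B)) x \<partial>lborel)"
    unfolding C_def
  proof (intro nn_integral_mono)
    fix x
    have "norm x \<le> 1 / B" if "norm (M x) < 1"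
      using B(2)[of x] that B(1) by (simp add: field_simps)
    then show "g (- M x) \<le> indicator (cball (0::'a) (1 / B)) x"
      by (auto simp: g_def indicator_def)
  qed
  also have "\<dots> < \<infinity>" using emeasure_lborel_cball_finite[of "0::'a" "1 / B"] by simp
  finally have "C < \<infinity>" .
  have "M (inv M y) = y" for y using assms(2) by (simp add: bij_is_surj surj_f_inv_f)
  then have shift: "M (inv M y + x) = y + M x" for x y
    using assms(1) by (simp add: linear_add)
  \<comment> \<open>Both sides evaluate the double integral of \<open>f (y + M x) * g y\<close>.
    With \<open>x\<close> integrated first, a translation by \<open>inv M y\<close> removes
    \<open>y\<close> from \<open>f\<close>; with \<open>y\<close> integrated first, a translation by
    \<open>M x\<close> moves the dependence on \<open>x\<close> into \<open>g\<close>.\<close>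
  have main: "(\<integral>\<^sup>+x. f (M x) \<partial>lborel) * a = C * (\<integral>\<^sup>+x. f x \<partial>lborel)"
    if [measurable]: "f \<in> borel_measurable borel" for f :: "'a \<Rightarrow> ennreal"
  proof -
    have "(\<integral>\<^sup>+x. f (M x) \<partial>lborel) * a = (\<integral>\<^sup>+y. (\<integral>\<^sup>+x. f (M x) \<partial>lborel) * g y \<partial>lborel)"
      unfolding a_def by (simp add: nn_integral_cmult)
    also have "\<dots> = (\<integral>\<^sup>+y. (\<integral>\<^sup>+x. f (y + M x) * g y \<partial>lborel) \<partial>lborel)"
    proof (rule nn_integral_cong)
      fix y
      have "(\<integral>\<^sup>+x. f (M x) \<partial>lborel) = (\<integral>\<^sup>+x. f (M (inv M y + x)) \<partial>lborel)"
        by (rule nn_integral_lborel_translate[symmetric]) measurable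
      then show "(\<integral>\<^sup>+x. f (M x) \<partial>lborel) * g y = (\<integral>\<^sup>+x. f (y + M x) * g y \<partial>lborel)"
        unfolding shift by (simp add: nn_integral_multc)
    qed
    also have "\<dots> = (\<integral>\<^sup>+x. (\<integral>\<^sup>+y. f (y + M x) * g y \<partial>lborel) \<partial>lborel)"
      by (intro lborel_pair.Fubini') measurable
    also have "\<dots> = (\<integral>\<^sup>+x. (\<integral>\<^sup>+y. f y * g (y - M x) \<partial>lborel) \<partial>lborel)"
    proof (rule nn_integral_cong)
      fix x
      show "(\<integral>\<^sup>+y. f (y + M x) * g y \<partial>lborel) = (\<integral>\<^sup>+y. f y * g (y - M x) \<partial>lborel)"
        using nn_integral_lborel_translate[of "\<lambda>y. f y * g (y - M x)" "M x"] by (simp add: add.commute)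
    qed
    also have "\<dots> = (\<integral>\<^sup>+y. (\<integral>\<^sup>+x. f y * g (y - M x) \<partial>lborel) \<partial>lborel)"
      by (intro lborel_pair.Fubini') measurable
    also have "\<dots> = (\<integral>\<^sup>+y. f y * C \<partial>lborel)"
    proof (rule nn_integral_cong)
      fix y
      have "(\<integral>\<^sup>+x. g (y - M x) \<partial>lborel) = (\<integral>\<^sup>+x. g (y - M (inv M y + x)) \<partial>lborel)"
        by (rule nn_integral_lborel_translate[symmetric]) measurable
      also have "\<dots> = C" unfolding shift C_def by simp
      finally show "(\<integral>\<^sup>+x. f y * g (y - M x) \<partial>lborel) = f y * C" by (simp add: nn_integral_cmult)
    qed
    also have "\<dots> = C * (\<integral>\<^sup>+x. f x \<partial>lborel)" by (subst nn_integral_multc) (auto simp: mult.commute)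
    finally show ?thesis .
  qed
  define k where "k = enn2real C / measure lborel (ball (0::'a) 1)"
  have C: "C = ennreal k * a"
    using \<open>C < \<infinity>\<close> a0 by (simp add: k_def a less_top flip: ennreal_mult)
  have "distr lborel borel M = density lborel (\<lambda>_. ennreal k)"
  proof (rule measure_eqI)
    fix A assume "A \<in> sets (distr lborel borel M)"
    then have A[measurable]: "A \<in> sets borel" by simp
    have "(\<integral>\<^sup>+x. indicator A (M x) \<partial>lborel) * a = C * emeasure lborel A"
      by (subst main) auto
    then have "(\<integral>\<^sup>+x. indicator A (M x) \<partial>lborel) * a = (ennreal k * emeasure lborel A) * a"
      by (simp add: C mult_ac)
    then have "(\<integral>\<^sup>+x. indicator A (M x) \<partial>lborel) = ennreal k * emeasure lborel A"
      using a a0 ennreal_mult_divide_eq[of a] by (metis ennreal_eq_0_iff ennreal_neq_top not_less)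
    moreover have "emeasure (distr lborel borel M) A = (\<integral>\<^sup>+x. indicator A (M x) \<partial>lborel)"
      by (simp add: nn_integral_distr flip: nn_integral_indicator)
    ultimately show "emeasure (distr lborel borel M) A = emeasure (density lborel (\<lambda>_. ennreal k)) A"
      by (simp add: emeasure_density nn_integral_cmult)
  qed simp
  moreover have "k \<ge> 0" by (simp add: k_def)
  ultimately show ?thesis by blast
qed

lemma integral_lborel_linear:
  fixes M :: "'a::euclidean_space \<Rightarrow> 'a"
  assumes "linear M" "bij M"
  shows "\<exists>k::real. \<forall>h :: 'a \<Rightarrow> complex. h \<in> borel_measurable borel \<longrightarrow>
    (\<integral>x. h (M x) \<partial>lborel) = k *\<^sub>R (\<integral>x. h x \<partial>lborel)"
proof -
  obtain k where k: "k \<ge> 0" "distr lborel borel M = density lborel (\<lambda>_. ennreal k)"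
    using distr_lborel_linear[OF assms] by blast
  have [measurable]: "M \<in> borel_measurable borel"
    using assms(1) by (intro borel_measurable_continuous_onI linear_continuous_on linear_conv_bounded_linear[THEN iffD1])
  have "(\<integral>x. h (M x) \<partial>lborel) = k *\<^sub>R (\<integral>x. h x \<partial>lborel)" if [measurable]: "h \<in> borel_measurable borel" for h :: "'a \<Rightarrow> complex"
  proof -
    have "(\<integral>x. h (M x) \<partial>lborel) = (\<integral>x. h x \<partial>distr lborel borel M)"
      by (subst integral_distr) auto
    also have "\<dots> = (\<integral>x. k *\<^sub>R h x \<partial>lborel)"
      unfolding k(2) using k(1) by (subst integral_density) auto
    finally show ?thesis by simp
  qed
  then show ?thesis by blast
qed

text \<open>The definition uses the gauge integral; the Bochner integral gives access to Fubini,
  image measures and dominated convergence.\<close>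

lemma fourier_transform_eq_lebesgue:
  fixes P :: "(real^'n) set"
  assumes "compact P"
  shows "fourier_transform P s = (\<integral>x. indicator P x *\<^sub>R exp (- \<i> * of_real (s \<bullet> x)) \<partial>lborel)"
proof -
  have "set_integrable lborel P (\<lambda>x. exp (- \<i> * complex_of_real (s \<bullet> x)))"
    unfolding set_integrable_def
    by (intro borel_integrable_compact assms continuous_intros)
  then show ?thesis
    unfolding fourier_transform_def by (subst set_borel_integral_eq_integral(2)[symmetric]) (auto simp: set_lebesgue_integral_def)
qed

lemma fourier_transform_translate:
  fixes P :: "(real^'n) set"
  assumes "compact P"
  shows "fourier_transform ((+) a ` P) s = exp (- \<i> * of_real (a \<bullet> s)) * fourier_transform P s"
proof -
  have c: "compact ((+) a ` P)" using assms compact_translation by blast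
  have [measurable]: "(+) a ` P \<in> sets borel" using c by (simp add: borel_compact)
  have "fourier_transform ((+) a ` P) s = (\<integral>x. indicator ((+) a ` P) x *\<^sub>R exp (- \<i> * of_real (s \<bullet> x)) \<partial>distr lborel borel ((+) a))"
    unfolding fourier_transform_eq_lebesgue[OF c] lborel_distr_plus ..
  also have "\<dots> = (\<integral>x. indicator ((+) a ` P) (a + x) *\<^sub>R exp (- \<i> * of_real (s \<bullet> (a + x))) \<partial>lborel)"
    by (subst integral_distr) auto
  also have "\<dots> = (\<integral>x. exp (- \<i> * of_real (a \<bullet> s)) * (indicator P x *\<^sub>R exp (- \<i> * of_real (s \<bullet> x))) \<partial>lborel)"
    by (intro Bochner_Integration.integral_cong refl)
       (auto simp: indicator_def inner_add_right exp_add[symmetric] algebra_simps inner_commute)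
  also have "\<dots> = exp (- \<i> * of_real (a \<bullet> s)) * fourier_transform P s"
    unfolding integral_mult_right_zero fourier_transform_eq_lebesgue[OF assms] ..
  finally show ?thesis .
qed

text \<open>In the standard basis Lebesgue measure is a product measure, and
  \<open>s \<bullet> L x\<close> is linear in the coordinates of \<open>x\<close> with weights
  \<open>L b \<bullet> s\<close>.\<close>

lemma fourier_transform_std_simplex:
  fixes L :: "real^'n \<Rightarrow> real^'n"
  assumes "linear L"
  shows "(\<integral>x. indicator (convex hull (insert 0 Basis)) x *\<^sub>R exp (- \<i> * of_real (s \<bullet> L x)) \<partial>lborel) =
    corner_fourier Basis 1 (\<lambda>b. L b \<bullet> s)"
proof -
  let ?T = "\<lambda>f. \<Sum>b\<in>Basis. f b *\<^sub>R b :: real^'n"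
  have [measurable]: "L \<in> borel_measurable borel"
    using assms(1) by (intro borel_measurable_continuous_onI linear_continuous_on linear_conv_bounded_linear[THEN iffD1])
  have "compact (convex hull (insert 0 Basis) :: (real^'n) set)"
    by (intro finite_imp_compact_convex_hull) auto
  then have [measurable]: "convex hull (insert 0 Basis) \<in> sets (borel :: (real^'n) measure)"
    by (rule borel_compact)
  have L: "s \<bullet> L (?T f) = (\<Sum>b\<in>Basis. f b * (L b \<bullet> s))" for f
    using assms by (simp add: linear_sum linear_scale inner_sum_right inner_commute)
  have "(\<integral>x. indicator (convex hull (insert 0 Basis)) x *\<^sub>R exp (- \<i> * of_real (s \<bullet> L x)) \<partial>lborel) =
    (\<integral>f. indicator (convex hull (insert 0 Basis)) (?T f) *\<^sub>R exp (- \<i> * of_real (s \<bullet> L (?T f))) \<partial>Pi\<^sub>M Basis (\<lambda>_. lborel))"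
    by (subst lborel_eq, subst integral_distr) auto
  also have "\<dots> = corner_fourier Basis 1 (\<lambda>b. L b \<bullet> s)"
    unfolding corner_fourier_def L
    by (intro Bochner_Integration.integral_cong refl) (simp add: std_simplex corner_simplex_def indicator_def)
  finally show ?thesis .
qed

text \<open>The simplex is the image of the standard one under \<open>a + L x\<close>, where
  \<open>L\<close> sends the basis to the edge vectors at \<open>a\<close>. These are enumerated by
  \<open>w\<close> and are nonzero by independence, as \<open>corner_fourier_exponential_sum\<close>
  requires. \<open>k\<close> is the constant of the change of variables; what matters is that it
  does not depend on \<open>s\<close>.\<close>

lemma fourier_transform_simplex:
  fixes C :: "(real^'n) set"
  assumes "\<not> affine_dependent C" "card C = CARD('n) + 1" "a \<in> C"
  obtains k :: real and w :: "real^'n \<Rightarrow> real^'n" where "inj_on w Basis" "0 \<notin> w ` Basis"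
    "\<And>s. fourier_transform (convex hull C) s = of_real k * (exp (- \<i> * of_real (a \<bullet> s)) * corner_fourier Basis 1 (\<lambda>b. w b \<bullet> s))"
proof -
  define B where "B = (\<lambda>x. - a + x) ` (C - {a})"
  have "finite C" using assms(2) card.infinite by fastforce
  have indB: "independent B" using affine_dependent_iff_dependent2[OF assms(3)] assms(1) by (simp add: B_def)
  have cardB: "card B = CARD('n)" and finB: "finite B"
    using assms \<open>finite C\<close> by (auto simp: B_def card_image inj_on_def)
  have "card (Basis :: (real^'n) set) = card B" by (simp add: cardB)
  then obtain w where w: "bij_betw w (Basis :: (real^'n) set) B"
    using finite_same_card_bij[of "Basis :: (real^'n) set" B] finB by auto
  define L where "L x = (\<Sum>b\<in>Basis. (x \<bullet> b) *\<^sub>R w b)" for x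
  have lin: "linear L"
    unfolding L_def[abs_def] by (rule linearI) (simp_all add: inner_add_left algebra_simps sum.distrib scaleR_sum_right)
  have Lb: "L b = w b" if "b \<in> Basis" for b
    using that unfolding L_def by (simp add: inner_Basis if_distrib[of "\<lambda>c. c *\<^sub>R _"] cong: if_cong)
  then have LB: "L ` Basis = B" using w by (auto simp: bij_betw_def image_def)
  have "span B = UNIV"
    using indB cardB finB by (metis dim_eq_full dim_span_eq_card_independent dim_span DIM_cart DIM_real mult_1_right)
  moreover have "span B = L ` span Basis"
    using lin LB linear_span_image by metis
  ultimately have "surj L" by simp
  then have "bij L" using lin linear_surjective_imp_injective by (auto simp: bij_def)
  define M where "M = inv L"
  have LM: "M (L x) = x" "L (M x) = x" for x
    using \<open>bij L\<close> by (auto simp: M_def bij_is_inj bij_is_surj surj_f_inv_f)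
  have linM: "linear M" unfolding M_def using lin \<open>bij L\<close> by (intro inj_linear_imp_inv_linear bij_is_inj)
  have bijM: "bij M" unfolding M_def using \<open>bij L\<close> by (rule bij_imp_bij_inv)
  define S where "S = convex hull (insert 0 Basis :: (real^'n) set)"
  have S: "compact S" unfolding S_def by (intro finite_imp_compact_convex_hull) auto
  then have [measurable]: "S \<in> sets borel" by (rule borel_compact)
  have LS: "compact (L ` S)"
    using S lin by (intro compact_continuous_image linear_continuous_on linear_conv_bounded_linear[THEN iffD1])
  have [measurable]: "L \<in> borel_measurable borel"
    using lin by (intro borel_measurable_continuous_onI linear_continuous_on linear_conv_bounded_linear[THEN iffD1])
  have "insert 0 B = L ` insert 0 Basis" using LB lin by (simp add: linear_0)
  moreover have "C = (+) a ` insert 0 B" using assms(3) by (auto simp: B_def image_image)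
  ultimately have T: "convex hull C = (+) a ` L ` S"
    by (simp only: convex_hull_translation convex_hull_linear_image[OF lin] S_def)
  obtain k :: real where k: "\<And>h :: real^'n \<Rightarrow> complex. h \<in> borel_measurable borel \<Longrightarrow>
    (\<integral>x. h (M x) \<partial>lborel) = k *\<^sub>R (\<integral>x. h x \<partial>lborel)"
    using integral_lborel_linear[OF linM bijM] by blast
  have "fourier_transform (convex hull C) s = of_real k * (exp (- \<i> * of_real (a \<bullet> s)) * corner_fourier Basis 1 (\<lambda>b. w b \<bullet> s))" for s
  proof -
    have "fourier_transform (L ` S) s = (\<integral>x. indicator S (M x) *\<^sub>R exp (- \<i> * of_real (s \<bullet> L (M x))) \<partial>lborel)"
      unfolding fourier_transform_eq_lebesgue[OF LS]
    proof (intro Bochner_Integration.integral_cong refl)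
      fix x
      have "x \<in> L ` S \<longleftrightarrow> M x \<in> S" using LM by (metis image_iff)
      then show "indicator (L ` S) x *\<^sub>R exp (- \<i> * complex_of_real (s \<bullet> x)) =
        indicator S (M x) *\<^sub>R exp (- \<i> * complex_of_real (s \<bullet> L (M x)))"
        by (simp add: LM indicator_def)
    qed
    also have "\<dots> = k *\<^sub>R (\<integral>x. indicator S x *\<^sub>R exp (- \<i> * of_real (s \<bullet> L x)) \<partial>lborel)"
      by (rule k) measurable
    also have "\<dots> = k *\<^sub>R corner_fourier Basis 1 (\<lambda>b. L b \<bullet> s)"
      unfolding S_def fourier_transform_std_simplex[OF lin] ..
    also have "corner_fourier Basis 1 (\<lambda>b. L b \<bullet> s) = corner_fourier Basis 1 (\<lambda>b. w b \<bullet> s)"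
      unfolding corner_fourier_def by (simp add: Lb cong: sum.cong)
    finally show ?thesis
      unfolding T fourier_transform_translate[OF LS] by (simp add: scaleR_conv_of_real)
  qed
  moreover have "inj_on w Basis" using w by (simp add: bij_betw_def)
  moreover have "0 \<notin> w ` Basis"
    using indB w by (metis bij_betw_def dependent_zero)
  ultimately show ?thesis using that by blast
qed

section \<open>Fourier transforms of polytopes\<close>

text \<open>The shape \<open>F s = (\<Sum>v\<in>V. (N v s / Q s) * exp (- \<i> * (v \<bullet> s)))\<close>, with coefficients homogeneous of degree
  \<open>-d\<close>; multiplying by \<open>Q\<close> avoids exceptional frequencies. Equal degree \<open>d\<close> of all summands is what makes
  the numerators of a sum homogeneous again.\<close>
definition exponential_rational_sum :: "nat \<Rightarrow> (real^'n \<Rightarrow> complex) \<Rightarrow> bool" where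
  "exponential_rational_sum d F \<longleftrightarrow> (\<exists>V l Q N. finite V \<and> homogeneous_poly (l + d) Q \<and> (\<exists>s. Q s \<noteq> 0) \<and>
     (\<forall>v\<in>V. homogeneous_poly l (N v)) \<and>
     (\<forall>s. Q s * F s = (\<Sum>v\<in>V. N v s * exp (- \<i> * of_real (v \<bullet> s)))))"

lemma exponential_rational_sumI:
  assumes "finite V" "homogeneous_poly (l + d) Q" "Q s0 \<noteq> 0" "\<And>v. v \<in> V \<Longrightarrow> homogeneous_poly l (N v)"
    "\<And>s. Q s * F s = (\<Sum>v\<in>V. N v s * exp (- \<i> * of_real (v \<bullet> s)))"
  shows "exponential_rational_sum d F"
  unfolding exponential_rational_sum_def using assms by (intro exI[of _ V] exI[of _ l] exI[of _ Q] exI[of _ N]) auto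

lemma exponential_rational_sumE:
  assumes "exponential_rational_sum d F"
  obtains V l Q N s0 where "finite V" "homogeneous_poly (l + d) Q" "Q s0 \<noteq> 0" "\<And>v. v \<in> V \<Longrightarrow> homogeneous_poly l (N v)"
    "\<And>s. Q s * F s = (\<Sum>v\<in>V. N v s * exp (- \<i> * of_real (v \<bullet> s)))"
proof -
  obtain V l Q N where *: "finite V \<and> homogeneous_poly (l + d) Q \<and> (\<exists>s. Q s \<noteq> 0) \<and>
     (\<forall>v\<in>V. homogeneous_poly l (N v)) \<and>
     (\<forall>s. Q s * F s = (\<Sum>v\<in>V. N v s * exp (- \<i> * of_real (v \<bullet> s))))"
    using assms unfolding exponential_rational_sum_def by (elim exE) (rule that)
  then obtain s0 where "Q s0 \<noteq> 0" by blast
  then show thesis using * by (intro that[of V l Q s0 N]) auto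
qed

text \<open>Even without frequencies the denominator has to be a nonzero form of degree exactly
  \<open>d\<close>; the \<open>d\<close>-th power of a coordinate serves.\<close>

lemma exponential_rational_sum_zero: "exponential_rational_sum d (\<lambda>s. 0)"
proof (rule exponential_rational_sumI[of "{}" 0 d "\<lambda>s. \<Prod>i<d. 1 * of_real (axis undefined 1 \<bullet> s)" "axis undefined 1"])
  show "homogeneous_poly (0 + d) (\<lambda>s. \<Prod>i<d. 1 * of_real (axis undefined 1 \<bullet> s))"
    using homogeneous_poly_prod[of "{..<d}" "\<lambda>_. 1" "\<lambda>_ s. 1 * of_real (axis undefined 1 \<bullet> s)"]
      homogeneous_poly_linear[of 1 "axis undefined 1"] by simp
qed (auto simp: inner_axis_axis)

lemma exponential_rational_sum_cmult:
  assumes "exponential_rational_sum d F"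
  shows "exponential_rational_sum d (\<lambda>s. c * F s)"
proof -
  obtain V l Q N s0 where *: "finite V" "homogeneous_poly (l + d) Q" "Q s0 \<noteq> 0" "\<And>v. v \<in> V \<Longrightarrow> homogeneous_poly l (N v)"
    "\<And>s. Q s * F s = (\<Sum>v\<in>V. N v s * exp (- \<i> * of_real (v \<bullet> s)))"
    by (rule exponential_rational_sumE[OF assms]) blast
  have "Q s * (c * F s) = (\<Sum>v\<in>V. (c * N v s) * exp (- \<i> * of_real (v \<bullet> s)))" for s
    using arg_cong[OF *(5)[of s], of "\<lambda>x. c * x"] by (simp add: sum_distrib_left mult_ac)
  moreover have "homogeneous_poly l (\<lambda>s. c * N v s)" if "v \<in> V" for v
    using homogeneous_poly_mult[OF homogeneous_poly_const[of c] *(4)[OF that]] by simp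
  ultimately show ?thesis
    using *(1-3) by (intro exponential_rational_sumI[of V l d Q s0 "\<lambda>v s. c * N v s"])
qed

lemma exponential_rational_sum_modulate:
  assumes "exponential_rational_sum d F"
  shows "exponential_rational_sum d (\<lambda>s. exp (- \<i> * of_real (a \<bullet> s)) * F s)"
proof -
  obtain V l Q N s0 where *: "finite V" "homogeneous_poly (l + d) Q" "Q s0 \<noteq> 0" "\<And>v. v \<in> V \<Longrightarrow> homogeneous_poly l (N v)"
    "\<And>s. Q s * F s = (\<Sum>v\<in>V. N v s * exp (- \<i> * of_real (v \<bullet> s)))"
    by (rule exponential_rational_sumE[OF assms]) blast
  have "Q s * (exp (- \<i> * of_real (a \<bullet> s)) * F s) = (\<Sum>v\<in>(+) a ` V. N (v - a) s * exp (- \<i> * of_real (v \<bullet> s)))" for s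
  proof -
    have "Q s * (exp (- \<i> * of_real (a \<bullet> s)) * F s) = exp (- \<i> * of_real (a \<bullet> s)) * (Q s * F s)"
      by (simp only: mult_ac)
    also have "\<dots> = (\<Sum>v\<in>V. N v s * exp (- \<i> * of_real ((a + v) \<bullet> s)))"
      unfolding *(5) sum_distrib_left
      by (rule sum.cong) (simp_all add: exp_add[symmetric] inner_add_left algebra_simps)
    also have "\<dots> = (\<Sum>v\<in>(+) a ` V. N (v - a) s * exp (- \<i> * of_real (v \<bullet> s)))"
      by (subst sum.reindex) (auto simp: inj_on_def)
    finally show ?thesis .
  qed
  then show ?thesis
    using * by (intro exponential_rational_sumI[of "(+) a ` V" l d Q s0 "\<lambda>v. N (v - a)"]) auto
qed

lemma exponential_rational_sum_add:
  assumes "exponential_rational_sum d F" "exponential_rational_sum d G"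
  shows "exponential_rational_sum d (\<lambda>s. F s + G s)"
proof -
  obtain V l Q N s0 where 1: "finite V" "homogeneous_poly (l + d) Q" "Q s0 \<noteq> 0" "\<And>v. v \<in> V \<Longrightarrow> homogeneous_poly l (N v)"
    "\<And>s. Q s * F s = (\<Sum>v\<in>V. N v s * exp (- \<i> * of_real (v \<bullet> s)))"
    by (rule exponential_rational_sumE[OF assms(1)]) blast
  obtain V' l' Q' N' s0' where 2: "finite V'" "homogeneous_poly (l' + d) Q'" "Q' s0' \<noteq> 0" "\<And>v. v \<in> V' \<Longrightarrow> homogeneous_poly l' (N' v)"
    "\<And>s. Q' s * G s = (\<Sum>v\<in>V'. N' v s * exp (- \<i> * of_real (v \<bullet> s)))"
    by (rule exponential_rational_sumE[OF assms(2)]) blast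
  \<comment> \<open>Cross-multiplication over the union of the frequency sets; both summands have
    degree \<open>l + l' + d\<close>.\<close>
  define M where "M v s = Q' s * (if v \<in> V then N v s else 0) + Q s * (if v \<in> V' then N' v s else 0)" for v s
  obtain s where s: "Q s * Q' s \<noteq> 0"
    using cpoly_fun_mult_nonzero[of Q Q' s0 s0'] 1(2,3) 2(2,3) unfolding homogeneous_poly_def by blast
  have M: "homogeneous_poly (l + l' + d) (M v)" for v
  proof -
    have a: "homogeneous_poly l (\<lambda>s. if v \<in> V then N v s else 0)"
      using 1(4) by (cases "v \<in> V") (auto simp: homogeneous_poly_zero)
    have b: "homogeneous_poly l' (\<lambda>s. if v \<in> V' then N' v s else 0)"
      using 2(4) by (cases "v \<in> V'") (auto simp: homogeneous_poly_zero)
    from homogeneous_poly_mult[OF 2(2) a] homogeneous_poly_mult[OF 1(2) b]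
    show ?thesis
      unfolding M_def[abs_def] by (intro homogeneous_poly_add) (simp_all add: ac_simps)
  qed
  have "Q s * Q' s * (F s + G s) = (\<Sum>v\<in>V \<union> V'. M v s * exp (- \<i> * of_real (v \<bullet> s)))" for s
  proof -
    have e: "Q s * Q' s * (F s + G s) = Q' s * (Q s * F s) + Q s * (Q' s * G s)" by (simp add: algebra_simps)
    have F: "Q s * F s = (\<Sum>v\<in>V \<union> V'. (if v \<in> V then N v s else 0) * exp (- \<i> * of_real (v \<bullet> s)))"
      unfolding 1(5) using 1(1) 2(1) by (intro sum.mono_neutral_cong_left) auto
    have G: "Q' s * G s = (\<Sum>v\<in>V \<union> V'. (if v \<in> V' then N' v s else 0) * exp (- \<i> * of_real (v \<bullet> s)))"
      unfolding 2(5) using 1(1) 2(1) by (intro sum.mono_neutral_cong_left) auto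
    show ?thesis
      unfolding e F G sum_distrib_left sum.distrib[symmetric] M_def
      by (rule sum.cong) (simp_all only: distrib_right mult.assoc)
  qed
  moreover have "homogeneous_poly (l + l' + d + d) (\<lambda>s. Q s * Q' s)"
    using homogeneous_poly_mult[OF 1(2) 2(2)] by (simp add: ac_simps)
  ultimately show ?thesis
    using M s 1(1) 2(1) by (intro exponential_rational_sumI[of "V \<union> V'" "l + l' + d" d "\<lambda>s. Q s * Q' s" s M]) auto
qed

lemma exponential_rational_sum_sum:
  "(\<And>i. i \<in> I \<Longrightarrow> exponential_rational_sum d (F i)) \<Longrightarrow> exponential_rational_sum d (\<lambda>s. \<Sum>i\<in>I. F i s)"
  by (induction I rule: infinite_finite_induct)
     (auto intro: exponential_rational_sum_zero exponential_rational_sum_add)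

lemma exponential_rational_sum_diff:
  assumes "exponential_rational_sum d F" "exponential_rational_sum d G"
  shows "exponential_rational_sum d (\<lambda>s. F s - G s)"
  using exponential_rational_sum_add[OF assms(1) exponential_rational_sum_cmult[OF assms(2), of "-1"]] by simp

lemma fourier_simplex_exponential_rational_sum:
  fixes C :: "(real^'n) set"
  assumes "\<not> affine_dependent C" "card C = CARD('n) + 1"
  shows "exponential_rational_sum CARD('n) (fourier_transform (convex hull C))"
proof -
  obtain a where "a \<in> C" using assms(2) by fastforce
  obtain k w where w: "inj_on w (Basis :: (real^'n) set)" "0 \<notin> w ` Basis"
    and F: "\<And>s. fourier_transform (convex hull C) s =
      of_real k * (exp (- \<i> * of_real (a \<bullet> s)) * corner_fourier Basis 1 (\<lambda>b. w b \<bullet> s))"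
    by (rule fourier_transform_simplex[OF assms \<open>a \<in> C\<close>]) (rule that)
  obtain l Q N where *: "homogeneous_poly (l + card (Basis :: (real^'n) set)) Q \<and> (\<exists>s. Q s \<noteq> 0) \<and> (\<forall>v. homogeneous_poly l (N v)) \<and>
    (\<forall>s. \<forall>r\<ge>0. Q s * corner_fourier Basis r (\<lambda>i. w i \<bullet> s) =
      (\<Sum>v\<in>insert 0 (w ` Basis). N v s * exp (- \<i> * of_real (r * (v \<bullet> s)))))"
    using corner_fourier_exponential_sum[OF finite_Basis w] by (elim exE) (rule that)
  then obtain s0 where "Q s0 \<noteq> 0" by blast
  have "Q s * corner_fourier Basis 1 (\<lambda>i. w i \<bullet> s) =
      (\<Sum>v\<in>insert 0 (w ` Basis). N v s * exp (- \<i> * of_real (v \<bullet> s)))" for s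
    using *[THEN conjunct2, THEN conjunct2, THEN conjunct2, rule_format, of 1 s] by simp
  then have "exponential_rational_sum CARD('n) (\<lambda>s. corner_fourier Basis 1 (\<lambda>b. w b \<bullet> s))"
    using * \<open>Q s0 \<noteq> 0\<close>
    by (intro exponential_rational_sumI[of "insert 0 (w ` Basis)" l _ Q s0 N]) simp_all
  then have "exponential_rational_sum CARD('n) (\<lambda>s. of_real k * (exp (- \<i> * of_real (a \<bullet> s)) * corner_fourier Basis 1 (\<lambda>b. w b \<bullet> s)))"
    by (intro exponential_rational_sum_cmult exponential_rational_sum_modulate)
  then show ?thesis using F by presburger
qed

lemma integrable_on_compact:
  fixes f :: "'a::euclidean_space \<Rightarrow> 'b::euclidean_space"
  assumes "compact P" "continuous_on P f"
  shows "f integrable_on P"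
  using borel_integrable_compact[OF assms] set_borel_integral_eq_integral(1)[of P f]
  by (simp add: set_integrable_def)

text \<open>In a triangulation distinct simplices overlap in null sets, so the transform is
  additive. Simplices of lower dimension contribute 0, and the others have
  \<open>CARD('n) + 1\<close> vertices.\<close>

lemma fourier_polytope_exponential_rational_sum:
  fixes P :: "(real^'n) set"
  assumes "polytope P"
  shows "exponential_rational_sum CARD('n) (fourier_transform P)"
proof -
  obtain T where T: "simplicial_complex T" "\<Union>T = P"
    by (rule simplicial_subdivision_of_cell_complex[of "{P}"])
      (use assms in \<open>auto simp: polytope_imp_convex face_of_refl\<close>)
  have simplex: "\<exists>n. n simplex K" if "K \<in> T" for K using T(1) that by (auto simp: simplicial_complex_def)
  have conv: "convex K" "compact K" if "K \<in> T" for K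
    using simplex[OF that] convex_simplex compact_simplex by auto
  have neg: "negligible K" if "convex K" "aff_dim K < CARD('n)" for K :: "(real^'n) set"
    using that low_dim_interior[of K] negligible_convex_interior[of K] by auto
  have "fourier_transform P s = (\<Sum>K\<in>T. fourier_transform K s)" for s
    unfolding fourier_transform_def T(2)[symmetric]
  proof (rule integral_unique, rule has_integral_Union)
    show "finite T" using T(1) by (simp add: simplicial_complex_def)
    show "((\<lambda>x. exp (- \<i> * complex_of_real (s \<bullet> x))) has_integral integral K (\<lambda>x. exp (- \<i> * complex_of_real (s \<bullet> x)))) K"
      if "K \<in> T" for K
      by (intro integrable_integral integrable_on_compact conv that continuous_intros)
    show "pairwise (\<lambda>S S'. negligible (S \<inter> S')) T"
    proof (rule pairwiseI)
      fix K K' assume K: "K \<in> T" "K' \<in> T" "K \<noteq> K'"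
      have f: "K \<inter> K' face_of K" "K' \<inter> K face_of K'"
        using T(1) K unfolding simplicial_complex_def by blast+
      \<comment> \<open>The common face is proper in at least one of the two distinct
        simplices.\<close>
      have "aff_dim (K \<inter> K') < CARD('n)"
      proof (cases "K \<inter> K' = K")
        case True
        then have "K' \<inter> K \<noteq> K'" using K by blast
        then have "aff_dim (K' \<inter> K) < aff_dim K'" using f conv K by (intro face_of_aff_dim_lt) auto
        then show ?thesis using aff_dim_le_DIM[of K'] by (simp add: Int_commute)
      next
        case False
        then have "aff_dim (K \<inter> K') < aff_dim K" using f conv K by (intro face_of_aff_dim_lt) auto
        then show ?thesis using aff_dim_le_DIM[of K] by simp
      qed
      then show "negligible (K \<inter> K')" using conv K by (intro neg convex_Int) auto
    qed
  qed
  moreover have "exponential_rational_sum CARD('n) (\<lambda>s. \<Sum>K\<in>T. fourier_transform K s)"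
  proof (rule exponential_rational_sum_sum)
    fix K assume K: "K \<in> T"
    show "exponential_rational_sum CARD('n) (fourier_transform K)"
    proof (cases "aff_dim K < CARD('n)")
      case True
      then have "fourier_transform K = (\<lambda>s. 0)"
        unfolding fourier_transform_def using neg conv(1)[OF K] by (auto intro!: integral_unique has_integral_negligible)
      then show ?thesis by (simp add: exponential_rational_sum_zero)
    next
      case False
      then have dim: "aff_dim K = CARD('n)" using aff_dim_le_DIM[of K] by simp
      obtain n where n: "n simplex K" using simplex[OF K] ..
      have "int CARD('n) simplex K" using n aff_dim_simplex[OF n] dim by simp
      then obtain C where "\<not> affine_dependent C" "int (card C) = int CARD('n) + 1" "K = convex hull C"
        unfolding simplex_def by (elim exE conjE) (rule that)
      then show ?thesis using fourier_simplex_exponential_rational_sum[of C] by simp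
    qed
  qed
  ultimately show ?thesis by presburger
qed

section \<open>Inclusion-exclusion for unions of polytopes\<close>

lemma fourier_transform_Un:
  fixes A B :: "(real^'n) set"
  assumes "compact A" "compact B"
  shows "fourier_transform (A \<union> B) s = fourier_transform A s + fourier_transform B s - fourier_transform (A \<inter> B) s"
proof -
  let ?e = "\<lambda>x. exp (- \<i> * complex_of_real (s \<bullet> x))"
  have i: "integrable lborel (\<lambda>x. indicator K x *\<^sub>R ?e x)" if "compact K" for K
    using that by (intro borel_integrable_compact continuous_intros)
  have "fourier_transform (A \<union> B) s =
    (\<integral>x. indicator A x *\<^sub>R ?e x + indicator B x *\<^sub>R ?e x - indicator (A \<inter> B) x *\<^sub>R ?e x \<partial>lborel)"
    unfolding fourier_transform_eq_lebesgue[OF compact_Un[OF assms]]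
    by (intro Bochner_Integration.integral_cong) (auto simp: indicator_def)
  also have "\<dots> = fourier_transform A s + fourier_transform B s - fourier_transform (A \<inter> B) s"
    unfolding fourier_transform_eq_lebesgue[OF assms(1)] fourier_transform_eq_lebesgue[OF assms(2)]
      fourier_transform_eq_lebesgue[OF compact_Int[OF assms]]
    using i[OF assms(1)] i[OF assms(2)] i[OF compact_Int[OF assms]]
    by (simp only: Bochner_Integration.integral_diff Bochner_Integration.integral_add Bochner_Integration.integrable_add)
  finally show ?thesis .
qed

text \<open>An indexed family, generalized over \<open>Q\<close>, lets the induction hypothesis
  apply to the intersections \<open>Q j \<inter> Q i\<close> as well. These may be empty or of lower
  dimension, hence \<open>polytope\<close> rather than full-dimensional pieces.\<close>

lemma fourier_Union_polytopes_exponential_rational_sum: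
  fixes Q :: "'i \<Rightarrow> (real^'n) set"
  assumes "finite I" "\<And>i. i \<in> I \<Longrightarrow> polytope (Q i)"
  shows "exponential_rational_sum CARD('n) (fourier_transform (\<Union>i\<in>I. Q i))"
  using assms
proof (induction I arbitrary: Q rule: finite_induct)
  case empty
  show ?case using fourier_polytope_exponential_rational_sum[OF polytope_empty] by simp
next
  case (insert j I)
  have c: "compact (Q j)" "compact (\<Union>i\<in>I. Q i)"
    using insert by (auto simp: polytope_imp_compact)
  have "fourier_transform (\<Union>i\<in>insert j I. Q i) =
    (\<lambda>s. fourier_transform (Q j) s + fourier_transform (\<Union>i\<in>I. Q i) s - fourier_transform (\<Union>i\<in>I. Q j \<inter> Q i) s)"
    using fourier_transform_Un[OF c] by (simp add: fun_eq_iff)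
  moreover have "exponential_rational_sum CARD('n) \<dots>"
    using insert by (intro exponential_rational_sum_diff exponential_rational_sum_add
      fourier_polytope_exponential_rational_sum insert.IH polytope_Int) auto
  ultimately show ?case by simp
qed

lemma fourier_generalized_polytope_exponential_rational_sum:
  fixes P :: "(real^'n) set"
  assumes "generalized_polytope P"
  shows "exponential_rational_sum CARD('n) (fourier_transform P)"
proof -
  obtain \<F> where "finite \<F>" "\<forall>Q\<in>\<F>. polytope Q" "P = \<Union>\<F>"
    using assms unfolding generalized_polytope_def convex_polytope_full_def by auto
  then show ?thesis using fourier_Union_polytopes_exponential_rational_sum[of \<F> "\<lambda>Q. Q"] by simp
qed

text \<open>Being contained in the closure of the interior excludes thin parts that the transform
  could not detect. Each convex piece has this property because its dimension is full.\<close>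

lemma generalized_polytope_compact_regular:
  assumes "generalized_polytope P"
  shows "compact P" "P \<subseteq> closure (interior P)"
proof -
  obtain \<F> where F: "finite \<F>" "\<forall>Q\<in>\<F>. polytope Q \<and> aff_dim Q = CARD('a)" "P = \<Union>\<F>"
    using assms unfolding generalized_polytope_def convex_polytope_full_def by auto
  then show "compact P" by (auto simp: polytope_imp_compact compact_Union)
  show "P \<subseteq> closure (interior P)"
  proof
    fix x assume "x \<in> P"
    then obtain Q where Q: "Q \<in> \<F>" "x \<in> Q" using F by auto
    have "convex Q" "interior Q \<noteq> {}"
      using F(2) Q \<open>x \<in> P\<close> interior_rel_interior_gen[of Q] rel_interior_eq_empty[of Q] polytope_imp_convex by auto
    then have "x \<in> closure (interior Q)"
      using Q convex_closure_interior closure_subset by blast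
    moreover have "interior Q \<subseteq> interior P" using F(3) Q by (intro interior_mono) auto
    ultimately show "x \<in> closure (interior P)" using closure_mono by blast
  qed
qed

section \<open>Injectivity of the Fourier transform\<close>

text \<open>The exponentials are exactly the kernels of the transform, so integrating one over
  \<open>P\<close> gives a multiple of \<open>fourier_transform P a\<close>.\<close>

inductive trigonometric_poly :: "(real^'n \<Rightarrow> complex) \<Rightarrow> bool" where
  exp: "trigonometric_poly (\<lambda>x. c * exp (- \<i> * of_real (a \<bullet> x)))"
| add: "trigonometric_poly f \<Longrightarrow> trigonometric_poly g \<Longrightarrow> trigonometric_poly (\<lambda>x. f x + g x)"

lemma trigonometric_poly_mult:
  assumes "trigonometric_poly f" "trigonometric_poly g"
  shows "trigonometric_poly (\<lambda>x. f x * g x)"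
  using assms(1)
proof induction
  case (exp c a)
  show ?case using assms(2)
  proof induction
    case (exp d b)
    have "c * exp (- \<i> * of_real (a \<bullet> x)) * (d * exp (- \<i> * of_real (b \<bullet> x))) =
      (c * d) * exp (- \<i> * of_real ((a + b) \<bullet> x))" for x
      by (simp add: exp_add[symmetric] inner_add_left algebra_simps)
    then show ?case by (simp only: trigonometric_poly.exp)
  next
    case (add f g)
    then show ?case by (simp only: distrib_left trigonometric_poly.add)
  qed
next
  case (add f g)
  then show ?case by (simp only: distrib_right trigonometric_poly.add)
qed

lemma trigonometric_poly_continuous_on: "trigonometric_poly f \<Longrightarrow> continuous_on S f"
  by (induction rule: trigonometric_poly.induct) (auto intro!: continuous_intros)

lemma trigonometric_poly_cos_sin:
  "trigonometric_poly (\<lambda>x. of_real (cos (a \<bullet> x)))" "trigonometric_poly (\<lambda>x. of_real (sin (a \<bullet> x)))"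
proof -
  have "complex_of_real (cos t) = (1/2) * exp (- \<i> * of_real t) + (1/2) * exp (- \<i> * of_real (- t))"
    "complex_of_real (sin t) = (\<i>/2) * exp (- \<i> * of_real t) + (-\<i>/2) * exp (- \<i> * of_real (- t))" for t
    by (simp_all add: cos_of_real[symmetric] sin_of_real[symmetric] cos_exp_eq sin_exp_eq field_simps)
  from this[of "a \<bullet> _"] show "trigonometric_poly (\<lambda>x. of_real (cos (a \<bullet> x)))" "trigonometric_poly (\<lambda>x. of_real (sin (a \<bullet> x)))"
    using trigonometric_poly.add[OF trigonometric_poly.exp[of "1/2" a] trigonometric_poly.exp[of "1/2" "-a"]]
      trigonometric_poly.add[OF trigonometric_poly.exp[of "\<i>/2" a] trigonometric_poly.exp[of "-\<i>/2" "-a"]]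
    by (simp_all only: inner_minus_left)
qed

lemma trigonometric_poly_approx:
  fixes g :: "real^'n \<Rightarrow> real"
  assumes "compact K" "continuous_on K g" "e > 0"
  obtains h where "trigonometric_poly (\<lambda>x. of_real (h x))" "\<And>x. x \<in> K \<Longrightarrow> \<bar>g x - h x\<bar> < e"
proof -
  have "\<exists>h. trigonometric_poly (\<lambda>x. of_real (h x)) \<and> (\<forall>x\<in>K. \<bar>g x - h x\<bar> < e)"
  proof (rule Stone_Weierstrass_HOL[OF assms(1) _ _ _ _ _ assms(2,3)])
    show "trigonometric_poly (\<lambda>x. of_real c)" for c
      using trigonometric_poly.exp[of "of_real c" 0] by simp
    show "continuous_on K f" if "trigonometric_poly (\<lambda>x. of_real (f x))" for f
      using continuous_on_Re[OF trigonometric_poly_continuous_on[OF that]] by simp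
    show "trigonometric_poly (\<lambda>x. of_real (f x + g x))"
      if "trigonometric_poly (\<lambda>x. of_real (f x)) \<and> trigonometric_poly (\<lambda>x. of_real (g x))" for f g
      using that trigonometric_poly.add by fastforce
    show "trigonometric_poly (\<lambda>x. of_real (f x * g x))"
      if "trigonometric_poly (\<lambda>x. of_real (f x)) \<and> trigonometric_poly (\<lambda>x. of_real (g x))" for f g
      using that trigonometric_poly_mult by fastforce
    show "\<exists>f. trigonometric_poly (\<lambda>x. of_real (f x)) \<and> f x \<noteq> f y" if "x \<in> K \<and> y \<in> K \<and> x \<noteq> y" for x y
    proof -
      \<comment> \<open>Scaled so that the phases at \<open>x\<close> and \<open>y\<close> differ by
        1, which is not a multiple of the period; equal sines and cosines would give
        \<open>cos 1 = 1\<close>.\<close>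
      define a where "a = (x - y) /\<^sub>R ((x - y) \<bullet> (x - y))"
      have "a \<bullet> x - a \<bullet> y = 1"
      proof -
        have "a \<bullet> x - a \<bullet> y = a \<bullet> (x - y)" by (simp add: inner_diff_right)
        then show ?thesis using that by (simp add: a_def)
      qed
      have "\<not> (sin (a \<bullet> x) = sin (a \<bullet> y) \<and> cos (a \<bullet> x) = cos (a \<bullet> y))"
      proof
        assume "sin (a \<bullet> x) = sin (a \<bullet> y) \<and> cos (a \<bullet> x) = cos (a \<bullet> y)"
        then have "cos (a \<bullet> x - a \<bullet> y) = 1" by (simp add: cos_diff flip: power2_eq_square)
        then have "cos 1 = (1::real)" by (simp add: \<open>a \<bullet> x - a \<bullet> y = 1\<close>)
        moreover have "cos 1 < cos (0::real)"
          using pi_gt3 by (intro cos_monotone_0_pi) auto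
        ultimately show False by simp
      qed
      then show ?thesis using trigonometric_poly_cos_sin[of a] by auto
    qed
  qed
  then show ?thesis using that by blast
qed

lemma integral_trigonometric_poly_eq:
  assumes "compact P" "compact Q" "\<And>s. fourier_transform P s = fourier_transform Q s" "trigonometric_poly f"
  shows "integral P f = integral Q f"
  using assms(4)
proof induction
  case (exp c a)
  show ?case using assms(3)[of a] by (simp only: fourier_transform_def integral_mult_right)
next
  case (add f g)
  have "integral K (\<lambda>x. f x + g x) = integral K f + integral K g" if "compact K" for K
    using that add by (intro Henstock_Kurzweil_Integration.integral_add integrable_on_compact trigonometric_poly_continuous_on)
  then show ?case using assms add by simp
qed

text \<open>If the inclusion fails, regularity of \<open>P\<close> yields a ball inside
  \<open>P\<close> and disjoint from \<open>Q\<close>. A bump supported there is seen by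
  \<open>P\<close> but not by \<open>Q\<close>, while its trigonometric approximations have equal
  integrals over both.\<close>

lemma fourier_transform_eq_imp_subset:
  fixes P Q :: "(real^'n) set"
  assumes P: "compact P" "P \<subseteq> closure (interior P)" and Q: "compact Q"
    and F: "\<And>s. fourier_transform P s = fourier_transform Q s"
  shows "P \<subseteq> Q"
proof (rule ccontr)
  assume "\<not> P \<subseteq> Q"
  then obtain x where "x \<in> - Q" "x \<in> closure (interior P)" using P by auto
  then have "- Q \<inter> interior P \<noteq> {}"
    using open_Int_closure_eq_empty[of "- Q" "interior P"] compact_imp_closed[OF Q] by (auto simp: open_Compl)
  then obtain y where "y \<in> - Q \<inter> interior P" by blast
  moreover have "open (- Q \<inter> interior P)" using compact_imp_closed[OF Q] by (intro open_Int) auto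
  ultimately obtain e where e: "e > 0" "ball y e \<subseteq> - Q \<inter> interior P"
    using open_contains_ball by blast
  \<comment> \<open>A tent: it vanishes outside the ball and is at least \<open>e / 2\<close> on the
    concentric ball of half the radius, which bounds its integral from below.\<close>
  define g where "g x = max 0 (e - dist y x)" for x
  have cg: "continuous_on S g" for S unfolding g_def by (intro continuous_intros)
  have gQ: "g x = 0" if "x \<in> Q" for x
  proof -
    have "x \<notin> ball y e" using e that by auto
    then show ?thesis by (simp add: g_def)
  qed
  have B: "cball y (e/2) \<subseteq> P" using e interior_subset[of P] by (fastforce simp: subset_iff)
  have "0 < e / 2 * measure lebesgue (cball y (e/2))" using e by simp
  also have "\<dots> = e / 2 * integral (cball y (e/2)) (\<lambda>x. 1)"
    by (subst lmeasure_integral) simp_all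
  also have "\<dots> = integral (cball y (e/2)) (\<lambda>x. e / 2)"
    by (subst integral_mult_right[symmetric]) simp
  also have "\<dots> \<le> integral (cball y (e/2)) g"
    by (intro integral_le integrable_on_compact cg) (auto simp: g_def max_def)
  also have "\<dots> \<le> integral P g"
    by (intro integral_subset_le integrable_on_compact cg B P) (auto simp: g_def)
  finally have pos: "0 < integral P g" .
  \<comment> \<open>The total volume turns a uniform error \<open>d\<close> into an error of at most
    \<open>d * m\<close> in the integrals.\<close>
  define m where "m = integral P (\<lambda>x. 1) + integral Q (\<lambda>x. 1 :: real)"
  have m0: "m \<ge> 0" unfolding m_def by (intro add_nonneg_nonneg integral_nonneg integrable_on_compact P Q) auto
  have "integral P g \<le> d * m" if "d > 0" for d
  proof -
    obtain h where h: "trigonometric_poly (\<lambda>x. of_real (h x))" "\<And>x. x \<in> P \<union> Q \<Longrightarrow> \<bar>g x - h x\<bar> < d"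
      using trigonometric_poly_approx[OF compact_Un[OF P(1) Q] cg \<open>d > 0\<close>] by metis
    have ch: "continuous_on S h" for S
      using continuous_on_Re[OF trigonometric_poly_continuous_on[OF h(1)]] by simp
    have "integral K (\<lambda>x. complex_of_real (h x)) = of_real (integral K h)" if "compact K" for K
      using integral_linear[OF integrable_on_compact[OF that ch] bounded_linear_of_real] by (simp add: o_def)
    then have "complex_of_real (integral P h) = of_real (integral Q h)"
      using P Q integral_trigonometric_poly_eq[OF P(1) Q F h(1)] by simp
    then have hh: "integral P h = integral Q h" by simp
    have b: "\<bar>integral K g - integral K h\<bar> \<le> d * integral K (\<lambda>x. 1)" if "compact K" "K \<subseteq> P \<union> Q" for K
    proof -
      have "integral K g - integral K h = integral K (\<lambda>x. g x - h x)"
        using that by (intro Henstock_Kurzweil_Integration.integral_diff[symmetric] integrable_on_compact cg ch)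
      also have "norm \<dots> \<le> integral K (\<lambda>x. d * 1)"
        using that h(2) by (intro Henstock_Kurzweil_Integration.integral_norm_bound_integral integrable_on_compact continuous_on_diff cg ch)
          (auto intro: less_imp_le)
      finally show ?thesis by (simp only: integral_mult_right real_norm_def)
    qed
    have "integral Q g = integral Q (\<lambda>x. 0)" by (intro integral_cong) (simp add: gQ)
    then have "integral Q g = 0" by simp
    then show ?thesis using b[of P] b[of Q] P Q hh by (simp add: m_def algebra_simps)
  qed
  \<comment> \<open>This \<open>d\<close> makes \<open>d * m\<close> smaller than
    \<open>integral P g\<close>; the added 1 keeps the denominator positive even for
    \<open>m = 0\<close>.\<close>
  from this[of "integral P g / (2 * (m + 1))"] pos m0 show False
    by (simp add: field_simps) (smt (verit) mult_less_cancel_left_pos mult_nonneg_nonneg)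
qed

text \<open>Serves to cancel \<open>Q\<close> at its zeros: two transforms that differ at a point
  differ on an open set.\<close>

lemma fourier_transform_continuous:
  fixes P :: "(real^'n) set"
  assumes P: "compact P"
  shows "continuous_on UNIV (fourier_transform P)"
  unfolding continuous_on_sequentially
proof (intro allI ballI impI)
  fix X :: "nat \<Rightarrow> real^'n" and s assume "(\<forall>n. X n \<in> UNIV) \<and> X \<longlonglongrightarrow> s"
  then have X: "X \<longlonglongrightarrow> s" by blast
  have [measurable]: "P \<in> sets borel" using P by (rule borel_compact)
  have "(\<lambda>n. \<integral>x. indicator P x *\<^sub>R exp (- \<i> * complex_of_real (X n \<bullet> x)) \<partial>lborel) \<longlonglongrightarrow>
    (\<integral>x. indicator P x *\<^sub>R exp (- \<i> * complex_of_real (s \<bullet> x)) \<partial>lborel)"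
  proof (rule integral_dominated_convergence[where w = "\<lambda>x. indicator P x *\<^sub>R 1"])
    show "integrable lborel (\<lambda>x. indicator P x *\<^sub>R (1::real))"
      by (intro borel_integrable_compact P continuous_intros)
    show "AE x in lborel. (\<lambda>n. indicator P x *\<^sub>R exp (- \<i> * complex_of_real (X n \<bullet> x))) \<longlonglongrightarrow>
      indicator P x *\<^sub>R exp (- \<i> * complex_of_real (s \<bullet> x))"
      by (intro AE_I2 tendsto_intros X)
  qed (auto simp: indicator_def)
  then show "(fourier_transform P \<circ> X) \<longlonglongrightarrow> fourier_transform P s"
    by (simp add: fourier_transform_eq_lebesgue[OF P] o_def)
qed

section \<open>Transforms on rationally parametrised hypersurfaces\<close>

lemma fourier_transform_eq_imp_eq:
  assumes "generalized_polytope P1" "generalized_polytope P2"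
    and "\<And>s. fourier_transform P1 s = fourier_transform P2 s"
  shows "P1 = P2"
  using fourier_transform_eq_imp_subset[of P1 P2] fourier_transform_eq_imp_subset[of P2 P1]
    generalized_polytope_compact_regular[OF assms(1)] generalized_polytope_compact_regular[OF assms(2)] assms(3)
  by (metis subset_antisym)

lemma cpoly_fun_polynomial_fun:
  assumes "polynomial_fun p"
  shows "cpoly_fun (\<lambda>x. of_real (p x))"
proof -
  obtain M c where "finite M" and p: "\<And>x. p x = (\<Sum>\<alpha>\<in>M. c \<alpha> * (\<Prod>i\<in>UNIV. (x $ i) ^ (\<alpha> i)))"
    using assms unfolding polynomial_fun_def by blast
  show ?thesis
    unfolding p of_real_sum of_real_mult of_real_prod of_real_power
    by (intro cpoly_fun_sum cpoly_fun_prod cpoly_fun_power cpoly_fun.intros)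
qed

text \<open>One denominator for all components gives all exponents
  \<open>v \<bullet> P t / W t\<close> the same denominator, and \<open>P\<close> and
  \<open>W\<close> are polynomial beyond \<open>D\<close> too.\<close>

lemma rp_param_common_denominator:
  fixes \<sigma> :: "real^'m \<Rightarrow> real^('m::finite option)"
  assumes "rp_param \<sigma> D"
  obtains P W where "\<And>j. cpoly_fun (\<lambda>t. of_real (P t $ j))" "cpoly_fun (\<lambda>t. of_real (W t))"
    "\<And>t. t \<in> D \<Longrightarrow> W t \<noteq> 0" "\<And>t. t \<in> D \<Longrightarrow> P t = W t *\<^sub>R \<sigma> t"
proof -
  have "\<forall>j. \<exists>p q. polynomial_fun p \<and> polynomial_fun q \<and> (\<forall>t\<in>D. q t \<noteq> 0 \<and> \<sigma> t $ j = p t / q t)"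
    using assms by (simp add: rp_param_def rational_fun_on_def)
  then obtain p q where pq: "\<And>j. polynomial_fun (p j)" "\<And>j. polynomial_fun (q j)"
    "\<And>j t. t \<in> D \<Longrightarrow> q j t \<noteq> 0" "\<And>j t. t \<in> D \<Longrightarrow> \<sigma> t $ j = p j t / q j t"
    by metis
  define W where "W t = (\<Prod>j\<in>UNIV. q j t)" for t
  define P :: "real^'m \<Rightarrow> real^('m option)" where "P t = (\<chi> j. p j t * (\<Prod>k\<in>UNIV - {j}. q k t))" for t
  show thesis
  proof (rule that)
    show "cpoly_fun (\<lambda>t. of_real (P t $ j))" for j
      unfolding P_def vec_lambda_beta of_real_mult of_real_prod
      by (intro cpoly_fun.mult cpoly_fun_prod cpoly_fun_polynomial_fun pq)
    show "cpoly_fun (\<lambda>t. of_real (W t))"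
      unfolding W_def of_real_prod by (intro cpoly_fun_prod cpoly_fun_polynomial_fun pq)
    show "W t \<noteq> 0" if "t \<in> D" for t using pq(3)[OF that] by (simp add: W_def)
    show "P t = W t *\<^sub>R \<sigma> t" if "t \<in> D" for t
    proof (rule vec_eq_iff[THEN iffD2], rule allI)
      fix j
      have "W t = q j t * (\<Prod>k\<in>UNIV - {j}. q k t)" unfolding W_def by (rule prod.remove) auto
      then show "P t $ j = (W t *\<^sub>R \<sigma> t) $ j" using pq(3,4)[OF that] by (simp add: P_def)
    qed
  qed
qed

text \<open>The standard chart of projective space, \<open>y\<close> to \<open>(1, y)\<close>, with
  \<open>None\<close> as the first coordinate.\<close>

definition affine_chart :: "real^'m \<Rightarrow> real^('m::finite option)" where
  "affine_chart y = (\<chi> j. case j of None \<Rightarrow> 1 | Some i \<Rightarrow> y $ i)"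

lemma affine_chart_normalized:
  assumes "\<sigma> t $ None \<noteq> 0"
  shows "\<sigma> t = (\<sigma> t $ None) *\<^sub>R affine_chart (normalized \<sigma> t)"
  using assms by (auto simp: vec_eq_iff affine_chart_def normalized_def split: option.split)

text \<open>Homogeneity carries zeros from the image of \<sigma> to the chart; there the interior
  point spreads them to all \<open>y\<close>, and homogeneity carries them back to every point with
  nonzero first coordinate, an open set.\<close>

lemma homogeneous_poly_zero_if_zero_on_param:
  fixes \<sigma> :: "real^'m \<Rightarrow> real^('m::finite option)"
  assumes N: "homogeneous_poly l N" and inner: "inner_point_condition \<sigma> O'"
    and nz: "\<And>t. t \<in> O' \<Longrightarrow> \<sigma> t $ None \<noteq> 0" and zero: "\<And>t. t \<in> O' \<Longrightarrow> N (\<sigma> t) = 0"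
  shows "N s = 0"
proof -
  have hom: "N (c *\<^sub>R x) = of_real c ^ l * N x" for c x using N by (simp add: homogeneous_poly_def)
  have "cpoly_fun N" using N by (simp add: homogeneous_poly_def)
  have "cpoly_fun (\<lambda>y. of_real (affine_chart y $ j))" for j :: "'m option"
    by (cases j) (auto simp: affine_chart_def intro: cpoly_fun.intros)
  then have chart: "cpoly_fun (\<lambda>y. N (affine_chart y))"
    by (intro cpoly_fun_compose[OF \<open>cpoly_fun N\<close>])
  obtain y0 where y0: "y0 \<in> interior (normalized \<sigma> ` O')"
    using inner unfolding inner_point_condition_def by blast
  have "N (affine_chart y) = 0" if y: "y \<in> interior (normalized \<sigma> ` O')" for y
  proof -
    obtain t where t: "t \<in> O'" "y = normalized \<sigma> t" using y interior_subset by blast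
    have "N (\<sigma> t) = N ((\<sigma> t $ None) *\<^sub>R affine_chart y)"
      unfolding t(2) by (rule arg_cong[where f = N], rule affine_chart_normalized, rule nz, rule t(1))
    then show ?thesis using zero[OF t(1)] nz[OF t(1)] by (simp add: hom)
  qed
  then have aff: "N (affine_chart y) = 0" for y
    by (rule cpoly_fun_eq_0_if_zero_on_open[OF chart open_interior y0])
  show ?thesis
  proof (rule cpoly_fun_eq_0_if_zero_on_open[OF \<open>cpoly_fun N\<close>])
    show "open {x :: real^('m option). x $ None \<noteq> 0}"
      by (intro open_Collect_neq continuous_intros)
    show "axis None 1 \<in> {x :: real^('m option). x $ None \<noteq> 0}" by simp
    show "N x = 0" if "x \<in> {x. x $ None \<noteq> 0}" for x
    proof -
      \<comment> \<open>A constant map makes an arbitrary \<open>x\<close> a value of a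
        parametrization; its argument is immaterial, hence \<open>undefined\<close>.\<close>
      have "N x = N ((x $ None) *\<^sub>R affine_chart (normalized (\<lambda>_. x) undefined))"
        using that by (intro arg_cong[where f = N] affine_chart_normalized[of "\<lambda>_. x"]) simp
      then show ?thesis by (simp add: hom aff)
    qed
  qed
qed

theorem theorem1:
  fixes P1 P2 :: "(real^('m::finite option)) set"
    and \<sigma> :: "real^'m \<Rightarrow> real^('m option)"
    and D O' :: "(real^'m) set"
  assumes "generalized_polytope P1" and "generalized_polytope P2"
    and "rp_param \<sigma> D"
    and "open O'" and "O' \<subseteq> D" and "\<forall>t\<in>O'. \<sigma> t $ None \<noteq> 0"
    and "hyperplane_condition \<sigma> O'" and "inner_point_condition \<sigma> O'"
    and "\<forall>t\<in>O'. fourier_transform P1 (\<sigma> t) = fourier_transform P2 (\<sigma> t)"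
  shows "P1 = P2"
proof (rule fourier_transform_eq_imp_eq[OF assms(1,2)])
  define F where "F s = fourier_transform P1 s - fourier_transform P2 s" for s
  have "exponential_rational_sum CARD('m option) F"
    unfolding F_def[abs_def]
    using assms(1,2) by (intro exponential_rational_sum_diff fourier_generalized_polytope_exponential_rational_sum)
  then obtain V l Q N s0 where V: "finite V" and Q: "homogeneous_poly (l + CARD('m option)) Q" "Q s0 \<noteq> 0"
    and N: "\<And>v. v \<in> V \<Longrightarrow> homogeneous_poly l (N v)"
    and QF: "\<And>s. Q s * F s = (\<Sum>v\<in>V. N v s * exp (- \<i> * of_real (v \<bullet> s)))"
    by (rule exponential_rational_sumE) (rule that)
  obtain P W where P: "\<And>j. cpoly_fun (\<lambda>t. of_real (P t $ j))" and W: "cpoly_fun (\<lambda>t. of_real (W t))"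
    and W0: "\<And>t. t \<in> D \<Longrightarrow> W t \<noteq> 0" and PW: "\<And>t. t \<in> D \<Longrightarrow> P t = W t *\<^sub>R \<sigma> t"
    by (rule rp_param_common_denominator[OF assms(3)]) (rule that)
  \<comment> \<open>All numerators have the same degree \<open>l\<close>, so replacing \<sigma>
    \<open>t\<close> by the polynomial vector \<open>P t\<close> multiplies the whole relation by a
    single nonzero factor.\<close>
  have NP: "N v (P t) = of_real (W t) ^ l * N v (\<sigma> t)" if "v \<in> V" "t \<in> O'" for v t
    using N[OF that(1)] PW[of t] that(2) assms(5) by (auto simp: homogeneous_poly_def)
  have "N v (P t) = 0" if "v \<in> V" "t \<in> O'" for v t
  proof (rule exponential_sum_coefficients_zero[of P W O' V "\<lambda>v t. N v (P t)"])
    show "\<exists>t. a \<bullet> P t \<noteq> b * W t" if a: "a \<noteq> 0" for a b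
    proof -
      have "\<not> \<sigma> ` O' \<subseteq> {x. a \<bullet> x = b}"
        using assms(7) a unfolding hyperplane_condition_def by blast
      then obtain t where t: "t \<in> O'" "a \<bullet> \<sigma> t \<noteq> b" by auto
      then have "a \<bullet> P t \<noteq> b * W t" using PW[of t] W0[of t] assms(5) by auto
      then show ?thesis ..
    qed
    show "cpoly_fun (\<lambda>t. N v (P t))" if "v \<in> V" for v
      by (rule cpoly_fun_compose[of "N v" P]) (use N[OF that] P in \<open>simp_all add: homogeneous_poly_def\<close>)
    show "(\<Sum>v\<in>V. N v (P t) * exp (- \<i> * of_real (v \<bullet> P t / W t))) = 0" if t: "t \<in> O'" for t
    proof -
      have "v \<bullet> P t / W t = v \<bullet> \<sigma> t" for v using PW[of t] W0[of t] t assms(5) by auto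
      then have "(\<Sum>v\<in>V. N v (P t) * exp (- \<i> * of_real (v \<bullet> P t / W t))) =
        of_real (W t) ^ l * (\<Sum>v\<in>V. N v (\<sigma> t) * exp (- \<i> * of_real (v \<bullet> \<sigma> t)))"
        unfolding sum_distrib_left by (intro sum.cong) (simp_all add: NP t)
      also have "\<dots> = of_real (W t) ^ l * (Q (\<sigma> t) * F (\<sigma> t))" by (simp only: QF)
      also have "\<dots> = 0" using assms(9) t by (simp add: F_def)
      finally show ?thesis .
    qed
  qed (use P W W0 V that assms(4,5) in auto)
  then have N\<sigma>: "N v (\<sigma> t) = 0" if "v \<in> V" "t \<in> O'" for v t
    using NP[OF that] W0[of t] that assms(5) by auto
  have "N v s = 0" if "v \<in> V" for v s
  proof (rule homogeneous_poly_zero_if_zero_on_param[OF N[OF that] assms(8)])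
    show "\<sigma> t $ None \<noteq> 0" if "t \<in> O'" for t using assms(6) that by blast
  qed (rule N\<sigma>[OF that])
  then have QF0: "Q s * F s = 0" for s by (simp add: QF)
  show "fourier_transform P1 s = fourier_transform P2 s" for s
  proof (rule ccontr)
    assume s: "fourier_transform P1 s \<noteq> fourier_transform P2 s"
    \<comment> \<open>\<open>Q\<close> may vanish at \<open>s\<close>, so equality there cannot be
      read off from \<open>QF0\<close>. But the transforms would differ near \<open>s\<close> as
      well, which forces \<open>Q\<close> to vanish on an open set and hence at
      \<open>s0\<close>.\<close>
    define U where "U = {s. fourier_transform P1 s \<noteq> fourier_transform P2 s}"
    have "open U" unfolding U_def
      by (intro open_Collect_neq fourier_transform_continuous generalized_polytope_compact_regular assms)
    have "Q s0 = 0"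
    proof (rule cpoly_fun_eq_0_if_zero_on_open)
      show "cpoly_fun Q" using Q(1) by (simp add: homogeneous_poly_def)
      show "s \<in> U" using s by (simp add: U_def)
      show "Q x = 0" if "x \<in> U" for x using QF0[of x] that by (simp add: F_def U_def)
    qed fact
    with Q(2) show False by simp
  qed
qed

end
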